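(* Let $G$ be a finite simple connected graph. Then $G$ satisfies property (P3) if and only if $G$ is a vertebrate graph.
   Context: For a connected graph $G$, $d(u,v)$ denotes the shortest-path distance in $G$, $N(x)$ the set of neighbours of $x$, and $N[x]=N(x)\cup\{x\}$; for a vertex set/induced subgraph $R$, $N[R]=\bigcup_{r\in V(R)}N[r]$. For $c,x\in V(G)$ with $d(c,x)\ge 2$, let $N(c,x)=\{v\in N(c): d(c,x)=1+d(v,x)\}$, and for an induced subgraph $R$ of $G$ let $N_R(c,x)=N(c,x)\cap V(R)$ (distances always taken in $G$). Property (P3): there exists an induced subgraph $R$ of $G$ with $N[R]=V(G)$ such that for all $c\in V(R)$, $x\in V(G)$ with $d(c,x)\ge 2$, there exists $c'\in N_R(c,x)$ such that for every $y\in V(G)$ with $d(c',y)\ge 2$, either $d(c,y)=d(c,c')+d(c',y)$ or $d(x,y)=d(x,c')+d(c',y)$. A block graph is a connected graph in which every block (maximal 2-connected subgraph) is complete. An extended block graph is a connected graph obtained from a block graph by replacing each cut vertex by a clique and joining every vertex of that clique to every neighbour of the replaced cut vertex. A simple connected graph $G$ is a vertebrate graph if it has an induced subgraph $B$ (the backbone) such that $B$ is an extended block graph, and for all $c\in V(B)$, $x\in V(G)$ with $d(c,x)\ge 2$ there exists $c'\in N_B(c,x)$ with $N[c']\supseteq N[v]$ for all $v\in N(c,x)$. *)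

theory Defs
  imports "Graph_Theory.Graph_Theory" "HOL-Library.Disjoint_Sets"
begin

text \<open>
  A finite simple graph is a \<^locale>\<open>pair_graph\<close>: an undirected edge is a pair of opposite arcs.
  Connectedness is \<^const>\<open>Digraph_Component.connected\<close>, which excludes the empty graph.
\<close>

section \<open>Distances and neighbourhoods\<close>

definition graph_dist :: "'a pair_pre_digraph \<Rightarrow> 'a \<Rightarrow> 'a \<Rightarrow> nat" where
  "graph_dist G u v = (LEAST n. \<exists>p. pre_digraph.apath (with_proj G) u p v \<and> length p = n)"

text \<open>The distance agrees with the library's weighted distance for unit weights.\<close>

lemma graph_dist_eq_mu:
  assumes "pair_graph G" and "u \<rightarrow>\<^sup>*\<^bsub>with_proj G\<^esub> v"
  shows "wf_digraph.\<mu> (with_proj G) (\<lambda>_. 1) u v = ereal (real (graph_dist G u v))"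
proof -
  interpret pair_graph G by fact
  have cost: "awalk_cost (\<lambda>_. 1) p = real (length p)" for p :: "('a \<times> 'a) list"
    by (induct p) auto
  obtain p where p: "apath u p v" "\<mu> (\<lambda>_. 1) u v = real (length p)"
    using min_cost_awalk[OF assms(2), of "\<lambda>_. 1"] by (auto simp: cost)
  have "graph_dist G u v = length p"
    unfolding graph_dist_def
  proof (rule Least_equality)
    show "\<exists>q. apath u q v \<and> length q = length p"
      using p(1) by blast
    fix n assume "\<exists>q. apath u q v \<and> length q = n"
    then obtain q where q: "apath u q v" "length q = n" by blast
    from q(1) have "awalk u q v" by (rule awalkI_apath)
    from min_cost_le_walk_cost[OF this, of "\<lambda>_. 1"] show "length p \<le> n"
      using p(2) q(2) by (simp add: cost)
  qed
  with p(2) show ?thesis by simp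
qed

definition neighbours :: "'a pair_pre_digraph \<Rightarrow> 'a \<Rightarrow> 'a set" where
  "neighbours G x = {v. x \<rightarrow>\<^bsub>with_proj G\<^esub> v}"

definition closed_neighbours :: "'a pair_pre_digraph \<Rightarrow> 'a \<Rightarrow> 'a set" where
  "closed_neighbours G x = insert x (neighbours G x)"

text \<open>\<open>N(c,x)\<close> in \<open>G\<close>; it is only used when \<open>d(c,x) \<ge> 2\<close>.\<close>

definition neighbours_towards :: "'a pair_pre_digraph \<Rightarrow> 'a \<Rightarrow> 'a \<Rightarrow> 'a set" where
  "neighbours_towards G c x =
     {v \<in> neighbours G c. graph_dist G c x = 1 + graph_dist G v x}"

section \<open>Property (P3)\<close>

definition property_P3 :: "'a pair_pre_digraph \<Rightarrow> bool" where
  "property_P3 G \<longleftrightarrow>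
     (\<exists>R :: 'a pair_pre_digraph. induced_subgraph (with_proj R) (with_proj G) \<and>
        (\<Union>r\<in>pverts R. closed_neighbours G r) = pverts G \<and>
        (\<forall>c\<in>pverts R. \<forall>x\<in>pverts G. graph_dist G c x \<ge> 2 \<longrightarrow>
           (\<exists>c' \<in> neighbours_towards G c x \<inter> pverts R.
              \<forall>y\<in>pverts G. graph_dist G c' y \<ge> 2 \<longrightarrow>
                graph_dist G c y = graph_dist G c c' + graph_dist G c' y \<or>
                graph_dist G x y = graph_dist G x c' + graph_dist G c' y)))"

section \<open>Block graphs and extended block graphs\<close>

text \<open>A vertex whose deletion separates two vertices of the same component.\<close>

definition cut_vertex :: "('a, 'b) pre_digraph \<Rightarrow> 'a \<Rightarrow> bool" where
  "cut_vertex G v \<longleftrightarrow> v \<in> verts G \<and>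
     (\<exists>x \<in> verts G - {v}. \<exists>y \<in> verts G - {v}.
        x \<rightarrow>\<^sup>*\<^bsub>G\<^esub> y \<and> \<not> x \<rightarrow>\<^sup>*\<^bsub>pre_digraph.del_vert G v\<^esub> y)"

text \<open>
  As usual in the definition of blocks, the complete graphs on one and two vertices count as
  2-connected, so that a bridge is a block. Requiring three vertices instead would
  give the same block graphs, since these two graphs are complete.
\<close>

definition two_connected :: "('a, 'b) pre_digraph \<Rightarrow> bool" where
  "two_connected H \<longleftrightarrow>
     graph H \<and> Digraph_Component.connected H \<and> (\<nexists>v. cut_vertex H v)"

definition block_of :: "('a, 'b) pre_digraph \<Rightarrow> ('a, 'b) pre_digraph \<Rightarrow> bool" where
  "block_of G H \<longleftrightarrow> pre_digraph.max_subgraph G two_connected H"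

definition block_graph :: "'a pair_pre_digraph \<Rightarrow> bool" where
  "block_graph G \<longleftrightarrow> pair_graph G \<and> Digraph_Component.connected (with_proj G) \<and>
     (\<forall>H. block_of (with_proj G) H \<longrightarrow> complete_digraph (card (verts H)) H)"

text \<open>
  Replace every vertex \<open>v\<close> of \<open>G\<close> by a clique on the vertex set \<open>K v\<close>, joining all of \<open>K u\<close>
  to all of \<open>K v\<close> whenever \<open>u\<close> and \<open>v\<close> are adjacent in \<open>G\<close>.
\<close>

definition clique_substitution ::
    "'a pair_pre_digraph \<Rightarrow> ('a \<Rightarrow> 'a set) \<Rightarrow> 'a pair_pre_digraph" where
  "clique_substitution G K =
     \<lparr> pverts = (\<Union>v\<in>pverts G. K v),
       parcs = {(a, b). a \<noteq> b \<and>
                  (\<exists>u\<in>pverts G. \<exists>v\<in>pverts G. a \<in> K u \<and> b \<in> K v \<and> (u = v \<or> u \<rightarrow>\<^bsub>with_proj G\<^esub> v))} \<rparr>"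

text \<open>
  Cliques are nonempty, and vertices that are not cut vertices are left unchanged. It is no
  restriction that \<open>G\<close> has the same vertex type as \<open>B\<close>: each replaced vertex can be renamed
  to an element of its clique.
\<close>

definition extended_block_graph :: "'a pair_pre_digraph \<Rightarrow> bool" where
  "extended_block_graph B \<longleftrightarrow> pair_graph B \<and> Digraph_Component.connected (with_proj B) \<and>
     (\<exists>(G :: 'a pair_pre_digraph) K. block_graph G \<and>
        disjoint_family_on K (pverts G) \<and>
        (\<forall>v\<in>pverts G. K v \<noteq> {}) \<and>
        (\<forall>v\<in>pverts G. \<not> cut_vertex (with_proj G) v \<longrightarrow> K v = {v}) \<and>
        B = clique_substitution G K)"

section \<open>Vertebrate graphs\<close>

definition vertebrate_graph :: "'a pair_pre_digraph \<Rightarrow> bool" where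
  "vertebrate_graph G \<longleftrightarrow> pair_graph G \<and> Digraph_Component.connected (with_proj G) \<and>
     (\<exists>B :: 'a pair_pre_digraph. induced_subgraph (with_proj B) (with_proj G) \<and>
        extended_block_graph B \<and>
        (\<forall>c\<in>pverts B. \<forall>x\<in>pverts G. graph_dist G c x \<ge> 2 \<longrightarrow>
           (\<exists>c' \<in> neighbours_towards G c x \<inter> pverts B.
              \<forall>v\<in>neighbours_towards G c x. closed_neighbours G v \<subseteq> closed_neighbours G c')))"

end

theory Submission
  imports Defs
begin

text \<open>
  Call the vertex \<open>c'\<close> chosen for a pair \<open>c\<close>, \<open>x\<close> the gate from \<open>c\<close> to \<open>x\<close>. In both directions
  the given vertex set can be thinned out: a vertex \<open>r\<close> with \<open>N[r] \<subseteq> N[s]\<close> for another chosen \<open>s\<close>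
  may be deleted, because \<open>s\<close> can replace \<open>r\<close> as a gate. The condition of (P3) on \<open>c'\<close> forces
  \<open>c'\<close> to dominate \<open>N(c,x)\<close>, so in a thinned set two nonadjacent vertices have at most one common
  neighbour \<open>v\<close>, and both sides of the theorem become equivalent to: \<open>v\<close> separates its
  nonadjacent neighbours within the set, that is, the set induces a block graph. From (P3) this
  follows since adjacent vertices have equal or adjacent gates seen from \<open>v\<close>, so a path avoiding
  \<open>v\<close> cannot leave a clique of \<open>N(v)\<close>. In an extended block graph the twins of \<open>v\<close> jointly
  separate, and thinning out removes the other twins.
\<close>

section \<open>Gates in a graph with its metric\<close>

text \<open>The facts on shortest paths that the argument needs, so that no walk appears in it.
  \<open>d_step\<close> supplies geodesics: it gives the vertex after \<open>x\<close> on a shortest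
  path to \<open>y\<close>.\<close>

locale graph_metric =
  fixes V :: "'a set" and adj :: "'a \<Rightarrow> 'a \<Rightarrow> bool" (infix "\<sim>" 50) and d :: "'a \<Rightarrow> 'a \<Rightarrow> nat"
  assumes finite_V: "finite V"
    and adj_V: "x \<sim> y \<Longrightarrow> x \<in> V \<and> y \<in> V"
    and adj_sym: "x \<sim> y \<Longrightarrow> y \<sim> x"
    and d_0: "\<lbrakk>x \<in> V; y \<in> V\<rbrakk> \<Longrightarrow> d x y = 0 \<longleftrightarrow> x = y"
    and d_1: "\<lbrakk>x \<in> V; y \<in> V\<rbrakk> \<Longrightarrow> d x y = 1 \<longleftrightarrow> x \<sim> y"
    and d_sym: "\<lbrakk>x \<in> V; y \<in> V\<rbrakk> \<Longrightarrow> d x y = d y x"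
    and d_tri: "\<lbrakk>x \<in> V; y \<in> V; z \<in> V\<rbrakk> \<Longrightarrow> d x z \<le> d x y + d y z"
    and d_step: "\<lbrakk>x \<in> V; y \<in> V; x \<noteq> y\<rbrakk> \<Longrightarrow> \<exists>z. x \<sim> z \<and> d x y = 1 + d z y"
begin

definition ball1 :: "'a \<Rightarrow> 'a set" where
  "ball1 x = insert x {y. x \<sim> y}"

text \<open>The set N(c,x), without a bound on the distance. For a neighbour \<open>x\<close> of
  \<open>c\<close> it is \<open>{x}\<close>, so that neighbours count as their own gates.\<close>

definition toward :: "'a \<Rightarrow> 'a \<Rightarrow> 'a set" where
  "toward c x = {v. c \<sim> v \<and> d c x = 1 + d v x}"

text \<open>The condition on gates in a vertebrate graph; \<open>splits\<close> below is the one in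
  (P3).\<close>

definition absorbs :: "'a \<Rightarrow> 'a \<Rightarrow> 'a \<Rightarrow> bool" where
  "absorbs c x c' \<longleftrightarrow> (\<forall>v\<in>toward c x. ball1 v \<subseteq> ball1 c')"

definition splits :: "'a \<Rightarrow> 'a \<Rightarrow> 'a \<Rightarrow> bool" where
  "splits c x c' \<longleftrightarrow> (\<forall>y\<in>V. 2 \<le> d c' y \<longrightarrow> d c y = d c c' + d c' y \<or> d x y = d x c' + d c' y)"

text \<open>The condition on gates is a parameter because thinning out, covering and connectedness
  are argued alike for \<open>absorbs\<close> and \<open>splits\<close>.\<close>

definition gated :: "('a \<Rightarrow> 'a \<Rightarrow> 'a \<Rightarrow> bool) \<Rightarrow> 'a set \<Rightarrow> bool" where
  "gated Q R \<longleftrightarrow> R \<subseteq> V \<and> R \<noteq> {} \<and>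
     (\<forall>c\<in>R. \<forall>x\<in>V. 2 \<le> d c x \<longrightarrow> (\<exists>c'\<in>toward c x \<inter> R. Q c x c'))"

definition irredundant :: "'a set \<Rightarrow> bool" where
  "irredundant R \<longleftrightarrow> (\<forall>r\<in>R. \<forall>s\<in>R. ball1 r \<subseteq> ball1 s \<longrightarrow> r = s)"

definition adj_on :: "'a set \<Rightarrow> 'a rel" where
  "adj_on S = {(s, t). s \<in> S \<and> t \<in> S \<and> s \<sim> t}"

text \<open>Block graphs without blocks: if \<open>R\<close> induces a connected subgraph, this says
  that it is a block graph. The closure of \<open>adj_on (R - {v})\<close> stands for the walks in
  \<open>R\<close> that avoid \<open>v\<close>.\<close>

definition locally_separated :: "'a set \<Rightarrow> bool" where
  "locally_separated R \<longleftrightarrow> (\<forall>v\<in>R. \<forall>a\<in>R. \<forall>b\<in>R. v \<sim> a \<longrightarrow> v \<sim> b \<longrightarrow>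
     (a, b) \<in> (adj_on (R - {v}))\<^sup>* \<longrightarrow> b \<in> ball1 a)"

lemma adj_irrefl: "\<not> x \<sim> x"
  using adj_V d_0 d_1 by (metis zero_neq_one)

lemma ball1_sym: "x \<in> ball1 y \<longleftrightarrow> y \<in> ball1 x"
  unfolding ball1_def by (auto intro: adj_sym)

lemma ball1_iff: "\<lbrakk>x \<in> V; y \<in> V\<rbrakk> \<Longrightarrow> y \<in> ball1 x \<longleftrightarrow> d x y \<le> 1"
  unfolding ball1_def using d_0[of x y] d_1[of x y] by (auto simp: le_Suc_eq)

lemma ball1_V: "\<lbrakk>x \<in> V; y \<in> ball1 x\<rbrakk> \<Longrightarrow> y \<in> V"
  unfolding ball1_def using adj_V by auto

lemma d_adj: "\<lbrakk>x \<sim> z; y \<in> V\<rbrakk> \<Longrightarrow> d x y \<le> 1 + d z y"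
  using d_tri[of x z y] d_1[of x z] adj_V by auto

lemma towardD:
  assumes "v \<in> toward c x"
  shows "c \<sim> v" "c \<in> V" "v \<in> V" "d c v = 1" "d c x = 1 + d v x"
  using assms d_1[of c v] adj_V unfolding toward_def by auto

lemma towardI: "\<lbrakk>c \<sim> v; x \<in> V; d v x < d c x\<rbrakk> \<Longrightarrow> v \<in> toward c x"
  unfolding toward_def using d_adj[of c v x] by auto

lemma gatedE:
  assumes "gated Q R" "c \<in> R" "x \<in> V" "2 \<le> d c x"
  obtains c' where "c' \<in> toward c x" "c' \<in> R" "Q c x c'"
  using assms unfolding gated_def by blast

lemma gated_subset: "gated Q R \<Longrightarrow> r \<in> R \<Longrightarrow> r \<in> V"
  unfolding gated_def by auto

section \<open>Domination of closed neighbourhoods\<close>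

text \<open>The second vertex of a geodesic from \<open>r\<close> to \<open>y\<close> lies in
  \<open>ball1 s\<close>, which gives \<open>s\<close> an equally short walk to \<open>y\<close>.
  The last hypothesis excludes \<open>r = y\<close>, where there is no such vertex and
  \<open>s\<close> may be at distance 1.\<close>

lemma d_dominated:
  assumes "ball1 r \<subseteq> ball1 s" "r \<in> V" "s \<in> V" "y \<in> V" "2 \<le> d s y \<or> r \<noteq> y"
  shows "d s y \<le> d r y"
proof -
  have "r \<noteq> y"
  proof
    assume "r = y"
    then have "y \<in> ball1 s" using assms by (auto simp: ball1_def)
    then show False using assms \<open>r = y\<close> ball1_iff[of s y] by auto
  qed
  with d_step[of r y] assms obtain z where z: "r \<sim> z" "d r y = 1 + d z y" by auto
  have "z \<in> V" using z adj_V by auto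
  have "z \<in> ball1 s" using z assms by (auto simp: ball1_def)
  then have "d s z \<le> 1" using ball1_iff[of s z] assms \<open>z \<in> V\<close> by auto
  then show ?thesis using d_tri[of s z y] z assms \<open>z \<in> V\<close> by auto
qed

text \<open>For \<open>w\<close> in \<open>ball1 v\<close> outside \<open>ball1 c'\<close>,
  splitting puts \<open>w\<close> at distance at least 3 from \<open>c\<close> or at least
  \<open>d x c' + 2\<close> from \<open>x\<close>. The routes through \<open>v\<close>, which is as
  far from \<open>x\<close> as \<open>c'\<close>, are shorter.\<close>

lemma splits_imp_absorbs:
  assumes c': "c' \<in> toward c x" and x: "x \<in> V" and split: "splits c x c'"
  shows "absorbs c x c'"
  unfolding absorbs_def
proof (intro ballI subsetI, rule ccontr)
  fix v w assume v: "v \<in> toward c x" and w: "w \<in> ball1 v" and n: "w \<notin> ball1 c'"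
  note C = towardD[OF c'] and D = towardD[OF v]
  have wV: "w \<in> V" using w D ball1_V by blast
  have vw: "d v w \<le> 1" using w D wV ball1_iff by auto
  have "2 \<le> d c' w" using n C wV ball1_iff[of c' w] by auto
  then have "d c w = d c c' + d c' w \<or> d x w = d x c' + d c' w"
    using split wV unfolding splits_def by auto
  moreover have "d c w \<le> 2" using d_tri[of c v w] D vw wV by auto
  moreover have "d x w \<le> d x v + d v w" using d_tri D wV x by auto
  moreover have "d x v = d x c'" using C D d_sym[of x v] d_sym[of x c'] x by auto
  ultimately show False using C D vw \<open>2 \<le> d c' w\<close> by auto
qed

lemma gated_splits_imp_absorbs: "gated splits R \<Longrightarrow> gated absorbs R"
  unfolding gated_def using splits_imp_absorbs by (meson IntD1)

lemma absorbs_mono: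
  "\<lbrakk>absorbs c x r; ball1 r \<subseteq> ball1 s\<rbrakk> \<Longrightarrow> absorbs c x s"
  unfolding absorbs_def by blast

text \<open>Both \<open>r\<close> and \<open>s\<close> are one step from \<open>c\<close> and
  equally far from \<open>x\<close>, and \<open>s\<close> is no farther from \<open>y\<close>. So
  the length through \<open>s\<close> is at most the one through \<open>r\<close>, and the triangle
  inequality gives the rest.\<close>

lemma splits_mono:
  assumes "splits c x r" "r \<in> toward c x" "s \<in> toward c x" "ball1 r \<subseteq> ball1 s" "x \<in> V"
  shows "splits c x s"
  unfolding splits_def
proof (intro ballI impI)
  fix y assume y: "y \<in> V" "2 \<le> d s y"
  note r = towardD[OF assms(2)] and s = towardD[OF assms(3)]
  have le: "d s y \<le> d r y" using d_dominated assms y r s by auto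
  then have "d c y = d c r + d r y \<or> d x y = d x r + d r y"
    using assms(1) y unfolding splits_def by auto
  moreover have "d c y \<le> d c s + d s y" "d x y \<le> d x s + d s y"
    using d_tri[of c s y] d_tri[of x s y] y s assms(5) by auto
  moreover have "d x s = d x r" using r s d_sym[of x r] d_sym[of x s] assms(5) by auto
  ultimately show "d c y = d c s + d s y \<or> d x y = d x s + d s y" using le r s by auto
qed

text \<open>Being at least as close to \<open>x\<close> as \<open>r\<close>, the vertex
  \<open>s\<close> differs from \<open>c\<close>; it is adjacent to \<open>c\<close> because
  \<open>c\<close> lies in \<open>ball1 r\<close>.\<close>

lemma toward_dominated:
  assumes r: "r \<in> toward c x" and x: "x \<in> V" "2 \<le> d c x" and s: "s \<in> V" "ball1 r \<subseteq> ball1 s"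
  shows "s \<in> toward c x"
proof -
  note r' = towardD[OF r]
  have "r \<noteq> x" using r' x d_0[of x x] by auto
  then have le: "d s x \<le> d r x" using d_dominated r' s x by auto
  then have "s \<noteq> c" using r' by auto
  have "c \<in> ball1 s" using r' s by (auto simp: ball1_def intro: adj_sym)
  then have "c \<sim> s" using \<open>s \<noteq> c\<close> by (auto simp: ball1_def intro: adj_sym)
  then show ?thesis using towardI le r' x by auto
qed

section \<open>Thinning out, covering and connectedness of gated sets\<close>

text \<open>If \<open>ball1 r\<close> lies in \<open>ball1 s\<close>, then \<open>r\<close> can be
  deleted: wherever \<open>r\<close> was the gate, \<open>s\<close> lies in the same
  \<open>toward c x\<close>, and \<open>mono\<close> hands it the property. Of two vertices with
  equal balls one is deleted as well.\<close>

lemma gated_irredundant_subset: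
  assumes mono: "\<And>c x r s. \<lbrakk>Q c x r; r \<in> toward c x; s \<in> toward c x; ball1 r \<subseteq> ball1 s; x \<in> V\<rbrakk> \<Longrightarrow> Q c x s"
    and "gated Q R"
  shows "\<exists>R'\<subseteq>R. gated Q R' \<and> irredundant R'"
  using assms(2)
proof (induction "card R" arbitrary: R rule: less_induct)
  case less
  show ?case
  proof (cases "irredundant R")
    case False
    then obtain r s where rs: "r \<in> R" "s \<in> R" "r \<noteq> s" "ball1 r \<subseteq> ball1 s"
      unfolding irredundant_def by auto
    have fin: "finite R" using less.prems finite_V finite_subset unfolding gated_def by auto
    have "gated Q (R - {r})"
      unfolding gated_def
    proof (intro conjI ballI impI)
      fix c x assume c: "c \<in> R - {r}" and x: "x \<in> V" "2 \<le> d c x"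
      from less.prems c x obtain c' where c': "c' \<in> toward c x" "c' \<in> R" "Q c x c'"
        by (auto elim: gatedE)
      show "\<exists>c'\<in>toward c x \<inter> (R - {r}). Q c x c'"
      proof (cases "c' = r")
        case True
        with toward_dominated[of r c x s] have "s \<in> toward c x"
          using c' x rs gated_subset[OF less.prems] by auto
        then show ?thesis using mono[of c x r s] c' x rs True by auto
      qed (use c' in auto)
    qed (use less.prems rs in \<open>auto simp: gated_def\<close>)
    moreover have "card (R - {r}) < card R" using fin rs by (meson card_Diff1_less)
    ultimately obtain R' where "R' \<subseteq> R - {r}" "gated Q R'" "irredundant R'"
      using less.hyps[of "R - {r}"] by auto
    then show ?thesis by blast
  qed (use less.prems in auto)
qed

text \<open>Passing from gate to gate lowers the distance to \<open>x\<close> until it is at most 1.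
  The covering condition of (P3) thus comes for free.\<close>

lemma gated_cover:
  assumes g: "gated Q R" and x: "x \<in> V"
  shows "\<exists>r\<in>R. x \<in> ball1 r"
proof -
  have "c \<in> R \<Longrightarrow> \<exists>r\<in>R. x \<in> ball1 r" for c
  proof (induction "d c x" arbitrary: c rule: less_induct)
    case less
    show ?case
    proof (cases "2 \<le> d c x")
      case True
      then obtain c' where "c' \<in> toward c x" "c' \<in> R" using gatedE g less.prems x by metis
      then show ?thesis using less.hyps[of c'] towardD(5)[of c' c x] by auto
    next
      case False
      then show ?thesis using ball1_iff[of c x] gated_subset[OF g] less.prems x by force
    qed
  qed
  then show ?thesis using g unfolding gated_def by auto
qed

lemma adj_onD: "(a, b) \<in> (adj_on S)\<^sup>* \<Longrightarrow> a \<in> S \<Longrightarrow> b \<in> S"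
  by (induction rule: rtrancl_induct) (auto simp: adj_on_def)

lemma adj_on_sym: "(a, b) \<in> (adj_on S)\<^sup>* \<Longrightarrow> (b, a) \<in> (adj_on S)\<^sup>*"
proof -
  have "sym (adj_on S)" by (auto simp: sym_def adj_on_def intro: adj_sym)
  then show "(a, b) \<in> (adj_on S)\<^sup>* \<Longrightarrow> (b, a) \<in> (adj_on S)\<^sup>*" by (meson sym_rtrancl symD)
qed

lemma adj_on_ball1: "\<lbrakk>b \<in> ball1 a; a \<in> S; b \<in> S\<rbrakk> \<Longrightarrow> (a, b) \<in> (adj_on S)\<^sup>*"
  by (auto simp: ball1_def adj_on_def)

text \<open>The descent used for covering, with its trace kept as a walk inside
  \<open>R\<close>.\<close>

lemma gated_connected:
  assumes g: "gated Q R" and "c \<in> R" "x \<in> R"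
  shows "(c, x) \<in> (adj_on R)\<^sup>*"
  using assms(2)
proof (induction "d c x" arbitrary: c rule: less_induct)
  case less
  have xV: "x \<in> V" "c \<in> V" using gated_subset[OF g] assms less.prems by auto
  show ?case
  proof (cases "2 \<le> d c x")
    case True
    then obtain c' where c': "c' \<in> toward c x" "c' \<in> R" using gatedE g less.prems xV by metis
    then have "(c', x) \<in> (adj_on R)\<^sup>*" using less.hyps[of c'] towardD(5)[of c' c x] by auto
    moreover have "(c, c') \<in> adj_on R" using c' towardD(1) less.prems by (auto simp: adj_on_def)
    ultimately show ?thesis by (rule converse_rtrancl_into_rtrancl[rotated])
  next
    case False
    then show ?thesis using ball1_iff[of c x] xV less.prems assms(3) adj_on_ball1[of x c R] by auto
  qed
qed

subsection \<open>(P3) implies local separation\<close>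

lemma absorbs_unique:
  assumes "irredundant R" "v \<in> toward c x" "v \<in> R" "w \<in> toward c x" "w \<in> R" "absorbs c x v" "absorbs c x w"
  shows "v = w"
proof -
  have "ball1 v \<subseteq> ball1 w" using assms(2,7) unfolding absorbs_def by blast
  then show ?thesis using assms(1,3,5) unfolding irredundant_def by blast
qed

text \<open>A common neighbour \<open>v\<close> lies in \<open>toward a b\<close>, so the absorbing
  gate dominates it and irredundancy identifies the two. With \<open>absorbs_unique\<close>,
  \<open>a\<close> and \<open>b\<close> have no other common neighbour in \<open>R\<close>.\<close>

lemma common_neighbour_absorbs:
  assumes "gated absorbs R" "irredundant R" "v \<in> R" "a \<in> R" "b \<in> R"
    "v \<sim> a" "v \<sim> b" "b \<notin> ball1 a"
  shows "v \<in> toward a b" "d a b = 2" "absorbs a b v"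
proof -
  have V: "a \<in> V" "b \<in> V" "v \<in> V" using assms adj_V by auto
  have vb: "d v b = 1" "d a v = 1" using assms(6,7) adj_sym[OF assms(6)] V d_1 by simp_all
  have ge: "2 \<le> d a b" using assms(8) ball1_iff V by force
  then show ab: "d a b = 2" using d_tri[of a v b] V vb by auto
  show t: "v \<in> toward a b" using towardI[of a v b] adj_sym[OF assms(6)] V ab vb by auto
  obtain g where g: "g \<in> toward a b" "g \<in> R" "absorbs a b g"
    using gatedE[OF assms(1) assms(4) V(2) ge] by metis
  then have "ball1 v \<subseteq> ball1 g" using t unfolding absorbs_def by auto
  then have "v = g" using g assms(2,3) unfolding irredundant_def by blast
  then show "absorbs a b v" using g by simp
qed

lemma gate_exists:
  assumes "gated Q R" "v \<in> R" "y \<in> R" "y \<noteq> v"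
  obtains g where "g \<in> toward v y" "g \<in> R"
proof (cases "2 \<le> d v y")
  case True
  then show ?thesis using gatedE assms gated_subset that by metis
next
  case False
  have V: "v \<in> V" "y \<in> V" using assms gated_subset by auto
  then have "d v y = 1" "d y y = 0" using d_0 False assms by (auto simp: le_Suc_eq) (metis False less_2_cases not_le)
  then show ?thesis using that[of y] assms V d_1 unfolding toward_def by auto
qed

lemma gated_splits_locally_separated:
  assumes g: "gated splits R" and irr: "irredundant R"
  shows "locally_separated R"
  unfolding locally_separated_def
proof (intro ballI impI)
  fix v a b assume R: "v \<in> R" "a \<in> R" "b \<in> R" "v \<sim> a" "v \<sim> b"
    and path: "(a, b) \<in> (adj_on (R - {v}))\<^sup>*"
  note gd = gated_splits_imp_absorbs[OF g]
  note V = gated_subset[OF g]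
  \<comment> \<open>The gate from \<open>p\<close> to \<open>q\<close> that splits also absorbs, and
    \<open>v\<close> is the only absorbing gate.\<close>
  have common: "splits p q v" if pq: "p \<in> R" "q \<in> R" "v \<sim> p" "v \<sim> q" "q \<notin> ball1 p" for p q
  proof -
    note c = common_neighbour_absorbs[OF gd irr R(1) that]
    obtain h where h: "h \<in> toward p q" "h \<in> R" "splits p q h"
      using gatedE[OF g pq(1) V[OF pq(2)]] c(2) by (metis order_refl)
    then have "absorbs p q h" using splits_imp_absorbs V that by auto
    then have "h = v" using absorbs_unique[OF irr h(1,2) c(1) R(1) _ c(3)] by auto
    then show ?thesis using h by auto
  qed
  \<comment> \<open>Otherwise \<open>v\<close> and \<open>q\<close> are two common neighbours of the
    nonadjacent \<open>p\<close> and \<open>r\<close>.\<close>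
  have trans: "r \<in> ball1 p" if P: "p \<in> R" "q \<in> R" "r \<in> R" "v \<sim> p" "v \<sim> q" "v \<sim> r" "q \<in> ball1 p" "r \<in> ball1 q" for p q r
  proof (rule ccontr)
    assume n: "r \<notin> ball1 p"
    then have pq: "q \<sim> p" "q \<sim> r" using P by (auto simp: ball1_def intro: adj_sym)
    have "v = q"
      using absorbs_unique[OF irr _ R(1) _ P(2)] common_neighbour_absorbs[OF gd irr R(1) P(1,3,4,6) n]
        common_neighbour_absorbs[OF gd irr P(2,1,3) pq n] by simp
    then show False using P adj_irrefl by simp
  qed
  \<comment> \<open>Otherwise \<open>v\<close> splits \<open>p\<close> and \<open>g'\<close>. As
    \<open>p\<close> is closer to \<open>y\<close> than \<open>v\<close>, it is the geodesic from
    \<open>g'\<close> to \<open>y\<close> that passes \<open>v\<close>; likewise the one from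
    \<open>p\<close> to \<open>z\<close>. Across the edge between \<open>y\<close> and
    \<open>z\<close>, each of the two would then be farther from \<open>v\<close> than the
    other.\<close>
  have gates_adjacent: "g' \<in> ball1 p" if yz: "y \<sim> z" "y \<in> R" "z \<in> R" "p \<in> R" "g' \<in> R" "p \<in> toward v y" "g' \<in> toward v z" for y z p g'
  proof (rule ccontr)
    assume n: "g' \<notin> ball1 p"
    note P = towardD[OF yz(6)] and G = towardD[OF yz(7)]
    have sp: "splits p g' v" using common yz P G n by auto
    have VV: "y \<in> V" "z \<in> V" "v \<in> V" using V yz R by auto
    have pg: "d p g' = 2" using common_neighbour_absorbs[OF gd irr R(1)] yz P G n by auto
    have sy: "d p v = 1" "d g' v = 1" "d g' p = 2" using P G pg d_sym[of p v] d_sym[of g' v] d_sym[of g' p] by simp_all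
    have one: "d g' y = 1 + d v y"
    proof (cases "2 \<le> d v y")
      case True
      then have "d p y = d p v + d v y \<or> d g' y = d g' v + d v y" using sp VV(1) unfolding splits_def by blast
      then show ?thesis using P(5) sy by linarith
    next
      case False
      \<comment> \<open>Here \<open>splits\<close> is silent, but \<open>y\<close> is a neighbour of
        \<open>v\<close> and so its own gate.\<close>
      then have "d p y = 0" using P(5) by linarith
      then have "p = y" using P(3) VV(1) d_0 by blast
      then show ?thesis using sy P(4) by simp
    qed
    have two: "d p z = 1 + d v z"
    proof (cases "2 \<le> d v z")
      case True
      then have "d p z = d p v + d v z \<or> d g' z = d g' v + d v z" using sp VV(2) unfolding splits_def by blast
      then show ?thesis using G(5) sy by linarith
    next
      case False
      then have "d g' z = 0" using G(5) by linarith
      then have "g' = z" using G(3) VV(2) d_0 by blast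
      then show ?thesis using pg G(4) by simp
    qed
    have "d y z = 1" "d z y = 1" using yz(1) adj_sym[OF yz(1)] VV d_1 by simp_all
    then have "d g' y \<le> d g' z + 1" "d p z \<le> d p y + 1"
      using d_tri[of g' z y] d_tri[of p y z] VV P(3) G(3) by simp_all
    then show False using one two P(5) G(5) by linarith
  qed
  have "a \<in> toward v a"
    using R d_1[of v a] d_0[of a a] V unfolding toward_def by auto
  \<comment> \<open>Invariant along the walk: all gates in \<open>R\<close> from \<open>v\<close> to
    the current vertex lie in \<open>ball1 a\<close>. At the ends, \<open>a\<close> and
    \<open>b\<close> are their own gates.\<close>
  have "\<forall>h\<in>toward v b \<inter> R. h \<in> ball1 a"
    using path
  proof (induction rule: rtrancl_induct)
    case base
    show ?case
    proof
      fix h assume "h \<in> toward v a \<inter> R"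
      then have "d h a = 0" "h \<in> V" using towardD[of h v a] R d_1[of v a] V by auto
      then show "h \<in> ball1 a" using d_0[of h a] R V by (simp add: ball1_def)
    qed
  next
    case (step y z)
    then have yz: "y \<sim> z" "y \<in> R" "z \<in> R" "y \<noteq> v" "z \<noteq> v" by (auto simp: adj_on_def)
    show ?case
    proof
      fix h assume h: "h \<in> toward v z \<inter> R"
      obtain p where p: "p \<in> toward v y" "p \<in> R" using gate_exists g R yz by metis
      then have "p \<in> ball1 a" using step by auto
      moreover have "h \<in> ball1 p"  using gates_adjacent[OF yz(1-3) p(2) _ p(1)] h by auto
      ultimately show "h \<in> ball1 a" using trans[of a p h] R p h towardD(1) by auto
    qed
  qed
  moreover have "b \<in> toward v b"
    using R d_1[of v b] d_0[of b b] V unfolding toward_def by auto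
  ultimately show "b \<in> ball1 a" using R by auto
qed

subsection \<open>Local separation implies (P3)\<close>

text \<open>Follow the gates from \<open>c\<close> towards \<open>y\<close>: either they reach a
  neighbour of \<open>y\<close> without meeting \<open>v\<close>, or \<open>v\<close> is one of them
  and lies on a geodesic. The walk stops next to \<open>y\<close> because \<open>y\<close> need not
  belong to \<open>R\<close>.\<close>

lemma gate_path:
  assumes g: "gated Q R" and v: "v \<in> V" and y: "y \<in> V"
  shows "\<lbrakk>c \<in> R; c \<noteq> v; c \<noteq> y\<rbrakk> \<Longrightarrow>
    (\<exists>b\<in>R. b \<sim> y \<and> (c, b) \<in> (adj_on (R - {v}))\<^sup>*) \<or> d c y = d c v + d v y"
proof (induction "d c y" arbitrary: c rule: less_induct)
  case less
  have cV: "c \<in> V" using gated_subset[OF g less.prems(1)] .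
  show ?case
  proof (cases "2 \<le> d c y")
    case True
    then obtain c' where c': "c' \<in> toward c y" "c' \<in> R" using gatedE g less.prems(1) y by metis
    note C = towardD[OF c'(1)]
    show ?thesis
    proof (cases "c' = v")
      case False
      have "c' \<noteq> y" using C(5) True d_0[of y y] y by auto
      then have IH: "(\<exists>b\<in>R. b \<sim> y \<and> (c', b) \<in> (adj_on (R - {v}))\<^sup>*) \<or> d c' y = d c' v + d v y"
        using less.hyps[of c'] C(5) c'(2) False by simp
      have "(c, c') \<in> adj_on (R - {v})" using C(1) c'(2) less.prems False by (simp add: adj_on_def)
      moreover have "d c y = d c v + d v y" if "d c' y = d c' v + d v y"
        using that d_tri[OF cV v y] d_tri[OF cV C(3) v] C(4,5) by linarith
      ultimately show ?thesis using IH by (meson converse_rtrancl_into_rtrancl)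
    qed (use C in auto)
  next
    case False
    then have "d c y = 1" using d_0[OF cV y] less.prems(3) by (simp add: not_le less_2_cases_iff)
    then show ?thesis using d_1[OF cV y] less.prems by blast
  qed
qed

text \<open>Otherwise the gate walks from \<open>a\<close> and \<open>p\<close> end at neighbours
  \<open>b\<close> and \<open>q\<close> of \<open>y\<close> in different components of
  \<open>R - {v}\<close>. These are nonadjacent with common neighbour \<open>y\<close>, so the gate
  \<open>h\<close> from \<open>b\<close> to \<open>q\<close> dominates \<open>y\<close>. Hence
  \<open>h\<close> is not \<open>v\<close>, yet it joins the two components.\<close>

lemma detour:
  assumes g: "gated absorbs R" and sep: "locally_separated R"
    and R: "v \<in> R" "a \<in> R" "v \<sim> a" and y: "y \<in> V" "2 \<le> d v y"
    and p: "p \<in> toward v y" "p \<in> R" "p \<notin> ball1 a"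
  shows "d a y = 1 + d v y"
proof (rule ccontr)
  assume n: "d a y \<noteq> 1 + d v y"
  note P = towardD[OF p(1)]
  have V: "a \<in> V" "v \<in> V" using gated_subset[OF g] R by auto
  have dav: "d a v = 1" using d_1[OF V] adj_sym[OF R(3)] by simp
  have "a \<noteq> v" "a \<noteq> y" using R(3) adj_irrefl y(2) d_1[OF V(2,1)] by auto
  then obtain b where b: "b \<in> R" "b \<sim> y" "(a, b) \<in> (adj_on (R - {v}))\<^sup>*"
    using gate_path[OF g V(2) y(1) R(2)] n dav by auto
  have "p \<noteq> v" "p \<noteq> y" using P y(2) adj_irrefl d_0[of y y] y(1) by auto
  \<comment> \<open>The second case of \<open>gate_path\<close> fails because \<open>p\<close> is
    closer to \<open>y\<close> than \<open>v\<close>.\<close>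
  then obtain q where q: "q \<in> R" "q \<sim> y" "(p, q) \<in> (adj_on (R - {v}))\<^sup>*"
    using gate_path[OF g V(2) y(1) p(2)] P(5) by auto
  have nopath: "(b, q) \<notin> (adj_on (R - {v}))\<^sup>*"
  proof
    assume "(b, q) \<in> (adj_on (R - {v}))\<^sup>*"
    then have "(a, p) \<in> (adj_on (R - {v}))\<^sup>*"
      using b(3) adj_on_sym[OF q(3)] by (meson rtrancl_trans)
    then show False using sep R P(1) p unfolding locally_separated_def by blast
  qed
  have in': "b \<in> R - {v}" "q \<in> R - {v}"
    using adj_onD[OF b(3)] adj_onD[OF q(3)] R p(2) \<open>a \<noteq> v\<close> \<open>p \<noteq> v\<close> by auto
  have bq: "b \<in> V" "q \<in> V" "q \<notin> ball1 b"
    using adj_on_ball1[OF _ in'] nopath b(1) q(1) gated_subset[OF g] by auto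
  have one: "d b y = 1" "d y q = 1" using d_1 b(2) adj_sym[OF q(2)] bq y(1) by simp_all
  have two: "2 \<le> d b q" using bq ball1_iff[OF bq(1,2)] by simp
  then have "y \<in> toward b q" using towardI[OF b(2) bq(2)] one by simp
  moreover obtain h where h: "h \<in> toward b q" "h \<in> R" "absorbs b q h"
    using gatedE[OF g b(1) bq(2) two] by metis
  ultimately have yh: "y \<in> ball1 h" unfolding absorbs_def ball1_def by blast
  have "d h q \<le> 1" using towardD(5)[OF h(1)] d_tri[OF bq(1) y(1) bq(2)] one by simp
  then have hq: "q \<in> ball1 h" "h \<in> ball1 b"
    using ball1_iff[of h q] towardD[OF h(1)] bq by (auto simp: ball1_def)
  have "h \<noteq> v" using yh y(2) ball1_iff[OF V(2) y(1)] by auto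
  then have "h \<in> R - {v}" using h(2) by simp
  then show False using nopath adj_on_ball1[OF hq(2) in'(1)] adj_on_ball1[OF hq(1)] in'(2)
    by (meson rtrancl_trans)
qed

text \<open>The walk \<open>p\<close>, \<open>q\<close>, \<open>r\<close> consists of neighbours of
  \<open>v\<close> and so avoids \<open>v\<close>. Hence the neighbours of \<open>v\<close> in
  \<open>R\<close> fall into cliques with no edges between them.\<close>

lemma ball1_trans_separated:
  assumes "locally_separated R" "v \<in> R" "p \<in> R" "q \<in> R" "r \<in> R" "v \<sim> p" "v \<sim> q" "v \<sim> r"
    "q \<in> ball1 p" "r \<in> ball1 q"
  shows "r \<in> ball1 p"
proof -
  have "(p, r) \<in> (adj_on (R - {v}))\<^sup>*"
    using adj_on_ball1[OF assms(9), of "R - {v}"] adj_on_ball1[OF assms(10), of "R - {v}"] assms(3-8) adj_irrefl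
    by (metis Diff_iff rtrancl_trans singletonD)
  then show ?thesis using assms unfolding locally_separated_def by blast
qed

text \<open>Here \<open>detour\<close> takes the place of splitting: with gates apart, each of
  \<open>x\<close> and \<open>y\<close> would be farther from \<open>v\<close> than the
  other.\<close>

lemma adjacent_gates:
  assumes g: "gated absorbs R" and sep: "locally_separated R" and v: "v \<in> R"
    and xy: "x \<sim> y" "2 \<le> d v x" "2 \<le> d v y"
    and q: "q \<in> toward v x" "q \<in> R" and p: "p \<in> toward v y" "p \<in> R"
  shows "p \<in> ball1 q"
proof (rule ccontr)
  assume n: "p \<notin> ball1 q"
  note P = towardD[OF p(1)] and Q = towardD[OF q(1)]
  have V: "x \<in> V" "y \<in> V" using adj_V[OF xy(1)] by auto
  have "d q y = 1 + d v y" using detour[OF g sep v q(2) Q(1) V(2) xy(3) p n] .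
  moreover have "d p x = 1 + d v x"
    using detour[OF g sep v p(2) P(1) V(1) xy(2) q] n ball1_sym by blast
  moreover have "d x y = 1" "d y x = 1" using d_1 V xy(1) adj_sym[OF xy(1)] by simp_all
  then have "d q y \<le> d q x + 1" "d p x \<le> d p y + 1"
    using d_tri[OF Q(3) V] d_tri[OF P(3) V(2,1)] by simp_all
  ultimately show False using P(5) Q(5) by linarith
qed

text \<open>While a geodesic from \<open>x\<close> stays at distance at least 2 from
  \<open>v\<close>, the gates of its vertices stay in the clique of \<open>q\<close>. It cannot
  arrive at \<open>y\<close> this way, since \<open>p\<close> is outside that clique.\<close>

lemma geodesic_near:
  assumes g: "gated absorbs R" and sep: "locally_separated R" and v: "v \<in> R"
    and y: "y \<in> V" "2 \<le> d v y" and p: "p \<in> toward v y" "p \<in> R"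
  shows "\<lbrakk>x \<in> V; 2 \<le> d v x; q \<in> toward v x; q \<in> R; p \<notin> ball1 q\<rbrakk> \<Longrightarrow>
    \<exists>w\<in>V. d v w \<le> 1 \<and> d x y = d x w + d w y"
proof (induction "d x y" arbitrary: x q)
  case 0
  then have "x = y" using d_0 y(1) by simp
  \<comment> \<open>Two gates of one vertex cannot be apart: \<open>q\<close> would be farther from
    \<open>y\<close> than \<open>v\<close> is.\<close>
  then have "d q y = 1 + d v y"
    using detour[OF g sep v _ _ y p] 0 towardD(1) by blast
  then show ?case using towardD(5)[of q v y] \<open>x = y\<close> 0 by simp
next
  case (Suc n)
  then obtain z where z: "x \<sim> z" "d x y = 1 + d z y"
    using d_step[of x y] y(1) d_0[of x y] by (metis nat.distinct(1))
  have zV: "z \<in> V" using adj_V z(1) by blast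
  have xz: "d x z = 1" using d_1 Suc zV z(1) by simp
  show ?case
  proof (cases "2 \<le> d v z")
    case True
    then obtain q' where q': "q' \<in> toward v z" "q' \<in> R" using gatedE[OF g v zV] by metis
    have "q' \<in> ball1 q" using adjacent_gates[OF g sep v z(1) _ True Suc(5,6) q'] Suc(4) by blast
    then have "p \<notin> ball1 q'"
      using ball1_trans_separated[OF sep v Suc(6) q'(2) p(2)] Suc(7) Suc(5) q' p towardD(1) by blast
    then obtain w where w: "w \<in> V" "d v w \<le> 1" "d z y = d z w + d w y"
      using Suc(1)[of z q'] Suc(2) z(2) zV True q' by auto
    have "d x y = d x w + d w y"
      using w(3) z(2) xz d_tri[OF Suc(3) zV w(1)] d_tri[OF Suc(3) w(1) y(1)] by linarith
    then show ?thesis using w by blast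
  next
    case False
    then show ?thesis using z(2) zV xz by (intro bexI[of _ z]) auto
  qed
qed

text \<open>Some geodesic from \<open>x\<close> to \<open>y\<close> has a vertex \<open>w\<close> in
  \<open>ball1 v\<close>. If \<open>w\<close> is closer to \<open>x\<close> than \<open>v\<close>,
  then \<open>q\<close> dominates \<open>w\<close>, so \<open>w\<close> is as far from
  \<open>y\<close> as \<open>q\<close> at least, which is \<open>1 + d v y\<close>: nothing is saved
  against the route through \<open>v\<close>. The case of \<open>y\<close> is symmetric.\<close>

lemma opposite_gates:
  assumes g: "gated absorbs R" and sep: "locally_separated R" and v: "v \<in> R"
    and x: "x \<in> V" "2 \<le> d v x" "q \<in> toward v x" "q \<in> R" "absorbs v x q"
    and y: "y \<in> V" "2 \<le> d v y" "p \<in> toward v y" "p \<in> R" "absorbs v y p"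
    and n: "p \<notin> ball1 q"
  shows "d x y = d x v + d v y"
proof -
  have vV: "v \<in> V" using gated_subset[OF g v] .
  note P = towardD[OF y(3)] and Q = towardD[OF x(3)]
  obtain w where w: "w \<in> V" "d v w \<le> 1" "d x y = d x w + d w y"
    using geodesic_near[OF g sep v y(1-4) x(1-4) n] by blast
  have qy: "d q y = 1 + d v y" using detour[OF g sep v x(4) Q(1) y(1-4) n] .
  have px: "d p x = 1 + d v x" using detour[OF g sep v y(4) P(1) x(1-4)] n ball1_sym by blast
  have le: "d x y \<le> d x v + d v y" using d_tri[OF x(1) vV y(1)] .
  have sym: "d x w = d w x" "d x v = d v x" using d_sym w(1) vV x(1) by auto
  have "w = v \<or> v \<sim> w" using w(2) ball1_iff[OF vV w(1)] by (auto simp: ball1_def)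
  then show ?thesis
  proof
    assume vw: "v \<sim> w"
    show ?thesis
    proof (rule ccontr)
      assume "d x y \<noteq> d x v + d v y"
      then have "d w x < d v x \<or> d w y < d v y" using le w(3) sym by linarith
      then show False
      proof
        assume "d w x < d v x"
        then have t: "w \<in> toward v x" using towardI[OF vw x(1)] by simp
        then have "ball1 w \<subseteq> ball1 q" using x(5) unfolding absorbs_def by blast
        then have "d q y \<le> d w y" using d_dominated[of w q y] w(1) Q(3) y(1) qy y(2) by simp
        then show False using qy w(3) towardD(5)[OF t] le sym \<open>d x y \<noteq> _\<close> by linarith
      next
        assume "d w y < d v y"
        then have t: "w \<in> toward v y" using towardI[OF vw y(1)] by simp
        then have "ball1 w \<subseteq> ball1 p" using y(5) unfolding absorbs_def by blast
        then have "d p x \<le> d w x" using d_dominated[of w p x] w(1) P(3) x(1) px x(2) by simp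
        then show False using px w(3) towardD(5)[OF t] le sym \<open>d x y \<noteq> _\<close> by linarith
      qed
    qed
  qed (use w in simp)
qed

text \<open>The gate \<open>p\<close> from \<open>c'\<close> to \<open>y\<close> decides: if it is
  apart from \<open>c\<close>, then \<open>detour\<close> puts \<open>c'\<close> on a geodesic from
  \<open>c\<close> to \<open>y\<close>; otherwise \<open>c'\<close> is shown to lie on one from
  \<open>x\<close> to \<open>y\<close>. The hard case is \<open>x\<close> adjacent to
  \<open>c'\<close>.\<close>

lemma separated_splits:
  assumes g: "gated absorbs R" and irr: "irredundant R" and sep: "locally_separated R"
    and c: "c \<in> R" and x: "x \<in> V" "2 \<le> d c x"
    and c': "c' \<in> toward c x" "c' \<in> R" "absorbs c x c'"
  shows "splits c x c'"
  unfolding splits_def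
proof (intro ballI impI)
  fix y assume y: "y \<in> V" "2 \<le> d c' y"
  note C = towardD[OF c'(1)]
  have adj: "c' \<sim> c" using adj_sym[OF C(1)] .
  obtain p where p: "p \<in> toward c' y" "p \<in> R" "absorbs c' y p"
    using gatedE[OF g c'(2) y] by metis
  note P = towardD[OF p(1)]
  have sym: "d x c' = d c' x" using d_sym x(1) C(3) by blast
  show "d c y = d c c' + d c' y \<or> d x y = d x c' + d c' y"
  proof (cases "p \<in> ball1 c")
    case False
    then show ?thesis using detour[OF g sep c'(2) c adj y p(1,2)] C(4) by simp
  next
    case True
    have "d x y = d x c' + d c' y"
    proof (cases "2 \<le> d c' x")
      case True
      then obtain q where q: "q \<in> toward c' x" "q \<in> R" "absorbs c' x q"
        using gatedE[OF g c'(2) x(1)] by metis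
      note Q = towardD[OF q(1)]
      \<comment> \<open>Since \<open>q\<close> is closer to \<open>x\<close> than \<open>c\<close>
        by 2, it is not in the clique of \<open>c\<close> and \<open>p\<close>.\<close>
      have "p \<notin> ball1 q"
      proof
        assume "p \<in> ball1 q"
        then have "q \<in> ball1 c"
          using ball1_trans_separated[OF sep c'(2) c p(2) q(2) adj P(1) Q(1) \<open>p \<in> ball1 c\<close>] ball1_sym by blast
        then have "d c q \<le> 1" using ball1_iff C(2) Q(3) by blast
        then show False using C(5) Q(5) d_tri[OF C(2) Q(3) x(1)] by linarith
      qed
      then show ?thesis using opposite_gates[OF g sep c'(2) x(1) True q y p] by simp
    next
      case False
      have c'x: "d c' x = 1" using False x(2) C(5) by linarith
      then have "c' \<sim> x" using d_1 C(3) x(1) by blast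
      \<comment> \<open>Otherwise \<open>p\<close> lies in \<open>toward c x\<close>, where
        irredundancy leaves only \<open>c'\<close>.\<close>
      have px: "x \<notin> ball1 p"
      proof
        assume xp: "x \<in> ball1 p"
        have "p \<noteq> x" using \<open>p \<in> ball1 c\<close> x ball1_iff[OF C(2) x(1)] by auto
        moreover have "p \<noteq> c" using xp x ball1_iff[OF C(2) x(1)] by auto
        ultimately have cp: "c \<sim> p" "p \<sim> x" using xp \<open>p \<in> ball1 c\<close> by (auto simp: ball1_def)
        then have "d p x = 1" using d_1 P(3) x(1) by blast
        then have "p \<in> toward c x" using towardI[OF cp(1) x(1)] x(2) by simp
        then have "ball1 p \<subseteq> ball1 c'" using c'(3) unfolding absorbs_def by blast
        then have "p = c'" using irr p(2) c'(2) unfolding irredundant_def by blast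
        then show False using P(1) adj_irrefl by simp
      qed
      have d2: "2 \<le> d p x" using px ball1_iff[OF P(3) x(1)] by simp
      have pc': "p \<sim> c'" using adj_sym[OF P(1)] .
      txt \<open>\<open>c'\<close> is also the gate from \<open>p\<close> to \<open>x\<close>, so \<open>p\<close> takes over the role of \<open>c\<close>.\<close>
      have c't: "c' \<in> toward p x" using towardI[OF pc' x(1)] c'x d2 by simp
      obtain z' where z': "z' \<in> toward p x" "z' \<in> R" "absorbs p x z'"
        using gatedE[OF g p(2) x(1) d2] by metis
      then have "ball1 c' \<subseteq> ball1 z'" using c't unfolding absorbs_def by blast
      then have "c' = z'" using irr c'(2) z'(2) unfolding irredundant_def by blast
      then have ab: "absorbs p x c'" using z'(3) by simp
      show ?thesis
      proof (rule ccontr)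
        assume n: "d x y \<noteq> d x c' + d c' y"
        then have le: "d x y \<le> d c' y" using d_tri[OF x(1) C(3) y(1)] sym c'x by linarith
        \<comment> \<open>All of \<open>toward c' y\<close> is absorbed by \<open>p\<close>, and
          \<open>ball1 p\<close> misses \<open>x\<close>.\<close>
        have not_toward: "u \<notin> toward c' y" if "x \<in> ball1 u" for u
          using that px p(3) unfolding absorbs_def by blast
        have xy: "d x y = d c' y"
        proof (rule ccontr)
          assume "d x y \<noteq> d c' y"
          then have "x \<in> toward c' y" using towardI[OF \<open>c' \<sim> x\<close> y(1)] le by simp
          then show False using not_toward[of x] by (simp add: ball1_def)
        qed
        then have "x \<noteq> y" using y(2) d_0[of y y] y(1) by auto
        \<comment> \<open>The next vertex \<open>z\<close> on a geodesic from \<open>x\<close> to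
          \<open>y\<close> leads to the contradiction: it is at distance 2 from \<open>c'\<close>,
          and the gate \<open>h\<close> to it is apart from \<open>p\<close>. By
          \<open>detour\<close>, \<open>h\<close> is farther from \<open>y\<close> than the route
          through \<open>z\<close> allows.\<close>
        then obtain z where z: "x \<sim> z" "d x y = 1 + d z y" using d_step x(1) y(1) by blast
        have zV: "z \<in> V" and xz: "x \<in> ball1 z" using adj_V z(1) adj_sym[OF z(1)] by (auto simp: ball1_def)
        have "\<not> c' \<sim> z"
          using not_toward[OF xz] towardI[of c' z y] y(1) z(2) xy by auto
        moreover have "c' \<noteq> z" using z(2) xy by auto
        ultimately have z2: "2 \<le> d c' z" using ball1_iff[OF C(3) zV] by (auto simp: ball1_def)
        obtain h where h: "h \<in> toward c' z" "h \<in> R" "absorbs c' z h"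
          using gatedE[OF g c'(2) zV z2] by metis
        note H = towardD[OF h(1)]
        have "d x z = 1" using d_1 x(1) zV z(1) by blast
        then have c'z: "d c' z = 2" using z2 c'x d_tri[OF C(3) x(1) zV] by linarith
        then have "x \<in> toward c' z" using towardI[OF \<open>c' \<sim> x\<close> zV] \<open>d x z = 1\<close> by simp
        then have xh: "x \<in> ball1 h" using h(3) unfolding absorbs_def ball1_def by blast
        \<comment> \<open>Otherwise \<open>h\<close> lies in \<open>toward p x\<close>, where
          \<open>c'\<close> dominates it.\<close>
        have "p \<notin> ball1 h"
        proof
          assume "p \<in> ball1 h"
          then have "h \<in> ball1 p" "h \<noteq> p" using ball1_sym px xh by auto
          then have ph: "p \<sim> h" by (simp add: ball1_def)
          have "d h x \<le> 1" using xh ball1_iff H(3) x(1) by blast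
          then have "h \<in> toward p x" using towardI[OF ph x(1)] d2 by simp
          then have "ball1 h \<subseteq> ball1 c'" using ab unfolding absorbs_def by blast
          then have "h = c'" using irr h(2) c'(2) unfolding irredundant_def by blast
          then show False using H(1) adj_irrefl by simp
        qed
        then have "d h y = 1 + d c' y" using detour[OF g sep c'(2) h(2) H(1) y p(1,2)] by simp
        then show False using d_tri[OF H(3) zV y(1)] H(5) c'z z(2) xy by linarith
      qed
    qed
    then show ?thesis by simp
  qed
qed

lemma separated_gated_splits:
  assumes "gated absorbs R" "irredundant R" "locally_separated R"
  shows "gated splits R"
proof -
  have "\<exists>c'\<in>toward c x \<inter> R. splits c x c'" if "c \<in> R" "x \<in> V" "2 \<le> d c x" for c x
    using gatedE[OF assms(1) that] separated_splits[OF assms that] by (metis IntI)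
  then show ?thesis using assms(1) unfolding gated_def by blast
qed

end

section \<open>Block graphs\<close>

text \<open>Reachability relates vertices only, while the closure is reflexive everywhere; hence the
  condition on \<open>a\<close>.\<close>

lemma reachable_del_vert_iff:
  assumes "wf_digraph H"
  shows "a \<rightarrow>\<^sup>*\<^bsub>pre_digraph.del_vert H w\<^esub> b \<longleftrightarrow> a \<in> verts H - {w} \<and>
    (a, b) \<in> (arcs_ends H \<inter> (verts H - {w}) \<times> (verts H - {w}))\<^sup>*"
proof -
  interpret wf_digraph H by fact
  interpret D: wf_digraph "del_vert w" by (rule wf_digraph_del_vert)
  have ends: "arcs_ends (del_vert w) = arcs_ends H \<inter> (verts H - {w}) \<times> (verts H - {w})"
    by (auto simp: arcs_ends_conv del_vert_simps)
  have "(a, b) \<in> (arcs_ends (del_vert w))\<^sup>* \<Longrightarrow> a \<in> verts (del_vert w) \<Longrightarrow> b \<in> verts (del_vert w)"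
    using D.reachable_conv' D.reachable_in_verts by blast
  then show ?thesis
    using D.reachable_conv[of a b] unfolding ends verts_del_vert by blast
qed

text \<open>Among the subgraphs above \<open>H\<close> with property \<open>P\<close>, one with the
  most vertices and arcs is maximal. It serves to find a block around a 2-connected
  subgraph.\<close>

lemma max_subgraph_exists:
  fixes G :: "('a, 'b) pre_digraph"
  assumes "fin_digraph G" "subgraph H G" "P H"
  obtains M where "subgraph H M" "pre_digraph.max_subgraph G P M"
proof -
  interpret fin_digraph G by fact
  let ?Q = "\<lambda>M. subgraph H M \<and> subgraph M G \<and> P M"
  let ?m = "\<lambda>M :: ('a, 'b) pre_digraph. card (verts M) + card (arcs M)"
  have sub: "verts M \<subseteq> verts N" "arcs M \<subseteq> arcs N" if "subgraph M N" for M N :: "('a, 'b) pre_digraph"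
    using that unfolding subgraph_def by auto
  have "?Q H" using assms by (auto simp: subgraph_def compatible_def)
  moreover have "\<forall>M. ?Q M \<longrightarrow> ?m M < Suc (?m G)"
    using sub finite_verts finite_arcs by (auto intro!: add_mono card_mono simp: less_Suc_eq_le)
  ultimately obtain M where M: "?Q M" "\<forall>N. ?Q N \<longrightarrow> ?m N \<le> ?m M"
    using ex_has_greatest_nat[of ?Q H ?m "Suc (?m G)"] by blast
  have "N = M" if N: "subgraph M N" "subgraph N G" "P N" for N
  proof -
    have fin: "finite (verts N)" "finite (arcs N)"
      using sub[OF N(2)] finite_verts finite_arcs by (blast intro: finite_subset)+
    have "subgraph H N" using M(1) N(1) subgraph_trans by blast
    then have "?m N \<le> ?m M" using M(2) N by blast
    moreover have "card (verts M) \<le> card (verts N)" "card (arcs M) \<le> card (arcs N)"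
      using sub[OF N(1)] fin by (auto intro: card_mono)
    ultimately have "card (verts M) = card (verts N)" "card (arcs M) = card (arcs N)" by linarith+
    then have "verts M = verts N" "arcs M = arcs N"
      using card_subset_eq[OF fin(1) sub(1)[OF N(1)]] card_subset_eq[OF fin(2) sub(2)[OF N(1)]] by auto
    then show ?thesis using N(1) unfolding subgraph_def compatible_def by simp
  qed
  then have "max_subgraph P M" unfolding max_subgraph_def using M(1) by blast
  then show thesis using that M(1) by blast
qed

lemma induced_pair_graph:
  assumes "pair_graph G" "S \<subseteq> pverts G"
  defines "R \<equiv> \<lparr>pverts = S, parcs = parcs G \<inter> S \<times> S\<rparr>"
  shows "pair_graph R" "induced_subgraph (with_proj R) (with_proj G)"
proof -
  interpret pair_graph G by fact
  have fin: "finite S" "finite (parcs G \<inter> S \<times> S)"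
    using finite_subset[OF assms(2) pair_finite_verts] pair_finite_arcs by auto
  have "symmetric (with_proj R)"
    unfolding symmetric_def R_def by (auto intro!: symI dest: arcs_symmetric)
  then show R: "pair_graph R"
    using fin by unfold_locales (auto simp: R_def dest: no_loops')
  interpret R: pair_graph R by fact
  show "induced_subgraph (with_proj R) (with_proj G)"
    using assms(2) R.wf_digraph wf_digraph unfolding induced_subgraph_def subgraph_def compatible_def
    by (auto simp: R_def)
qed

lemma induced_subgraph_pairD:
  assumes "induced_subgraph (with_proj R) (with_proj G)"
  shows "pverts R \<subseteq> pverts G" "parcs R = parcs G \<inter> pverts R \<times> pverts R"
  using assms unfolding induced_subgraph_def subgraph_def by auto

lemma connected_pair_iff:
  assumes "pair_graph G"
  shows "Digraph_Component.connected (with_proj G) \<longleftrightarrow>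
    pverts G \<noteq> {} \<and> (\<forall>u\<in>pverts G. \<forall>v\<in>pverts G. (u, v) \<in> (parcs G)\<^sup>*)"
proof -
  interpret pair_graph G by fact
  have "symcl (parcs G) = parcs G"
    unfolding symcl_def using arcs_symmetric by auto
  moreover have "(u, v) \<in> rtrancl_on (pverts G) (parcs G) \<longleftrightarrow> (u, v) \<in> (parcs G)\<^sup>*"
    if "u \<in> pverts G" "v \<in> pverts G" for u v
    using rtrancl_consistent_rtrancl_on[of u v "parcs G" "pverts G"] that rtrancl_on_rtranclI in_arcsD2
    by metis
  ultimately show ?thesis using connected_conv[of "with_proj G"] by auto
qed

section \<open>Block graphs and local separation\<close>

text \<open>Walks in a block shrink to single arcs: if \<open>u\<close> is adjacent to
  \<open>s\<close> and \<open>t\<close>, then \<open>u\<close> is no cut vertex of the block, and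
  \<open>sep\<close> at \<open>u\<close> makes \<open>s\<close> and \<open>t\<close> equal or
  adjacent.\<close>

lemma block_graphI:
  assumes R: "pair_graph R" and con: "Digraph_Component.connected (with_proj R)"
    and sep: "\<And>v a b. \<lbrakk>(v, a) \<in> parcs R; (v, b) \<in> parcs R;
      (a, b) \<in> (parcs R \<inter> (pverts R - {v}) \<times> (pverts R - {v}))\<^sup>*\<rbrakk> \<Longrightarrow> a = b \<or> (a, b) \<in> parcs R"
  shows "block_graph R"
  unfolding block_graph_def
proof (intro conjI allI impI R con)
  interpret pair_graph R by fact
  fix H assume "block_of (with_proj R) H"
  then have H: "subgraph H (with_proj R)" "two_connected H"
    and max: "\<And>M. \<lbrakk>subgraph H M; subgraph M (with_proj R); two_connected M\<rbrakk> \<Longrightarrow> M = H"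
    unfolding block_of_def max_subgraph_def by auto
  have V: "verts H \<subseteq> pverts R" and A: "arcs H \<subseteq> parcs R" and th: "tail H = fst" "head H = snd"
    using H(1) unfolding subgraph_def compatible_def by auto
  define I where "I = \<lparr>pverts = verts H, parcs = parcs R \<inter> verts H \<times> verts H\<rparr>"
  \<comment> \<open>A subgraph of \<open>R\<close> inherits \<open>fst\<close> and
    \<open>snd\<close> as tail and head, so it can be read as a pair graph.\<close>
  obtain H' where H': "with_proj H' = H" "pverts H' = verts H" "parcs H' = arcs H"
  proof
    show "with_proj \<lparr>pverts = verts H, parcs = arcs H\<rparr> = H" by (simp add: with_proj_def th)
  qed simp_all
  have I: "pair_graph I" "induced_subgraph (with_proj I) (with_proj R)"
    unfolding I_def using induced_pair_graph[OF R V] by auto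
  have gH: "graph H" and cH: "Digraph_Component.connected H" and nH: "\<not> cut_vertex H w" for w
    using H(2) unfolding two_connected_def by auto
  have pH: "pair_graph H'" using gH pair_graphI_graph[of H'] unfolding H' by blast
  interpret H: graph H by fact
  interpret I: pair_graph I by fact
  have AI: "arcs H \<subseteq> parcs I"
    using A H.wellformed th unfolding I_def by fastforce
  have ends: "arcs_ends H = arcs H" using with_proj_simps(3)[of H'] unfolding H' .
  have reach: "(x, y) \<in> (arcs H)\<^sup>*" if "x \<in> verts H" "y \<in> verts H" for x y
    using cH connected_pair_iff[OF pH] that unfolding H' by blast
  have avoid: "(x, y) \<in> (arcs H \<inter> (verts H - {w}) \<times> (verts H - {w}))\<^sup>*"
    if "x \<in> verts H - {w}" "y \<in> verts H - {w}" for x y w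
  proof (cases "w \<in> verts H")
    case True
    have "x \<rightarrow>\<^sup>*\<^bsub>H\<^esub> y"
      using reach[of x y] that H.reachable_conv[of x y] ends by auto
    then have "x \<rightarrow>\<^sup>*\<^bsub>pre_digraph.del_vert H w\<^esub> y"
      using nH[of w] True that unfolding cut_vertex_def by blast
    then show ?thesis unfolding reachable_del_vert_iff[OF H.wf_digraph] ends by blast
  next
    case False
    have "arcs H \<inter> (verts H - {w}) \<times> (verts H - {w}) = arcs H"
      using False H.wellformed th by fastforce
    then show ?thesis using reach that by simp
  qed
  \<comment> \<open>Adding the missing arcs between vertices of \<open>H\<close> keeps it
    2-connected, so by maximality \<open>H\<close> is already induced.\<close>
  have con_I: "Digraph_Component.connected (with_proj I)"
    using cH rtrancl_mono[OF AI] unfolding connected_pair_iff[OF I(1)]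
      connected_pair_iff[OF pH, unfolded H'] by (auto simp: I_def)
  have "\<not> cut_vertex (with_proj I) w" for w
  proof -
    have "arcs H \<inter> (verts H - {w}) \<times> (verts H - {w}) \<subseteq> parcs I \<inter> (verts H - {w}) \<times> (verts H - {w})"
      using AI by auto
    from rtrancl_mono[OF this] show ?thesis
      unfolding cut_vertex_def reachable_del_vert_iff[OF I.wf_digraph]
      using avoid[of _ w] by (auto simp: I_def)
  qed
  then have "two_connected (with_proj I)"
    unfolding two_connected_def using con_I I.pair_graphD_graph by blast
  moreover have "subgraph H (with_proj I)"
    unfolding subgraph_def compatible_def using AI th H.wf_digraph I.wf_digraph by (auto simp: I_def)
  ultimately have HI: "with_proj I = H" using max[of "with_proj I"] I(2) unfolding induced_subgraph_def by blast
  then have arcs: "arcs H = parcs R \<inter> verts H \<times> verts H"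
    unfolding I_def with_proj_def by (metis pair_pre_digraph.select_convs(2) pre_digraph.select_convs(2))
  have "t = s \<or> (s, t) \<in> arcs H" if "(s, t) \<in> (arcs H)\<^sup>*" "s \<in> verts H" for s t
    using that(1)
  proof (induction rule: rtrancl_induct)
    case (step u t)
    show ?case
    proof (cases "u = s \<or> t = s")
      case False
      then have us: "(u, s) \<in> arcs H" "(s, u) \<in> arcs H" "(u, t) \<in> arcs H"
        using step(2,3) arcs_symmetric unfolding arcs by blast+
      then have "s \<in> verts H - {u}" "t \<in> verts H - {u}" using arcs no_loops'[OF A[THEN subsetD, OF us(1)]] no_loops'[OF A[THEN subsetD, OF us(3)]] by auto
      from avoid[OF this] have "(s, t) \<in> (parcs R \<inter> (pverts R - {u}) \<times> (pverts R - {u}))\<^sup>*"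
        using rtrancl_mono[of "arcs H \<inter> (verts H - {u}) \<times> (verts H - {u})"
            "parcs R \<inter> (pverts R - {u}) \<times> (pverts R - {u})"] A V by blast
      then show ?thesis using sep[of u s t] us arcs by auto
    qed (use step in auto)
  qed simp
  then have "(s, t) \<in> arcs H" if "s \<in> verts H" "t \<in> verts H" "s \<noteq> t" for s t
    using reach that by blast
  then show "complete_digraph (card (verts H)) H"
    unfolding complete_digraph_def ends using gH arcs by (auto dest: no_loops')
qed

text \<open>In a walk of least length no vertex repeats, since the part in between could be cut
  out.\<close>

lemma rtrancl_injective_path:
  assumes "(a, b) \<in> r\<^sup>*"
  obtains f n where "f 0 = a" "f n = b" "\<And>i. i < n \<Longrightarrow> (f i, f (Suc i)) \<in> r" "inj_on f {..n::nat}"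
proof -
  define n where "n = (LEAST n. (a, b) \<in> r ^^ n)"
  have "(a, b) \<in> r ^^ n" using assms unfolding n_def rtrancl_power by (rule LeastI_ex)
  then obtain f where f: "f 0 = a" "f n = b" "\<forall>i<n. (f i, f (Suc i)) \<in> r"
    unfolding relpow_fun_conv by blast
  have least: "n \<le> m" if "(a, b) \<in> r ^^ m" for m
    using that unfolding n_def by (rule Least_le)
  have seg: "(f i, f (i + k)) \<in> r ^^ k" if "i + k \<le> n" for i k
    unfolding relpow_fun_conv using f(3) that by (intro exI[of _ "\<lambda>j. f (i + j)"]) auto
  have "f i \<noteq> f j" if "i < j" "j \<le> n" for i j
  proof
    assume eq: "f i = f j"
    have "(a, f i) \<in> r ^^ i" "(f j, b) \<in> r ^^ (n - j)"
      using seg[of 0 i] seg[of j "n - j"] f that by auto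
    then have "(a, b) \<in> r ^^ (i + (n - j))" unfolding relpow_add eq by blast
    then show False using least[of "i + (n - j)"] that by simp
  qed
  then have "inj_on f {..n}" by (intro linorder_inj_onI) auto
  then show thesis using that f by blast
qed

lemma rtrancl_segment:
  assumes "i \<le> j" "\<And>k. \<lbrakk>i \<le> k; k < j\<rbrakk> \<Longrightarrow> (f k, f (Suc k)) \<in> r"
  shows "(f i, f j) \<in> r\<^sup>*"
  using assms by (induction rule: dec_induct) (auto intro: rtrancl_into_rtrancl)

text \<open>An injective path from \<open>a\<close> to \<open>b\<close> closes up through
  \<open>v\<close> to a cycle, or to an edge if \<open>a = b\<close>. The subgraph induced on it is
  2-connected, hence part of a block, and blocks are complete.\<close>

lemma block_graph_separated:
  assumes "block_graph R" and arcs: "(v, a) \<in> parcs R" "(v, b) \<in> parcs R"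
    and path: "(a, b) \<in> (parcs R \<inter> (pverts R - {v}) \<times> (pverts R - {v}))\<^sup>*"
  shows "a = b \<or> (a, b) \<in> parcs R"
proof -
  have R: "pair_graph R" and complete: "\<And>H. block_of (with_proj R) H \<Longrightarrow> complete_digraph (card (verts H)) H"
    using assms(1) unfolding block_graph_def by auto
  interpret pair_graph R by fact
  obtain f n where f: "f 0 = a" "f n = b" and inj: "inj_on f {..n::nat}"
    and step: "\<And>i. i < n \<Longrightarrow> (f i, f (Suc i)) \<in> parcs R \<inter> (pverts R - {v}) \<times> (pverts R - {v})"
    using rtrancl_injective_path[OF path] by metis
  define S where "S = insert v (f ` {..n})"
  have fV: "f i \<in> pverts R - {v}" if "i \<le> n" for i
    using that step[of "i - 1"] f(1) in_arcsD2[OF arcs(1)] no_loops'[OF arcs(1)] by (cases i) auto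
  have SR: "S \<subseteq> pverts R" unfolding S_def using fV in_arcsD1[OF arcs(1)] by auto
  define I where "I = \<lparr>pverts = S, parcs = parcs R \<inter> S \<times> S\<rparr>"
  have I: "pair_graph I" "induced_subgraph (with_proj I) (with_proj R)"
    unfolding I_def using induced_pair_graph[OF R SR] by auto
  interpret I: pair_graph I by fact
  txt \<open>\<open>S\<close> carries a cycle, so it stays connected when at most one vertex is removed.\<close>
  have robust: "(x, y) \<in> (parcs R \<inter> T \<times> T)\<^sup>*"
    if T: "T \<subseteq> S" "S - {w} \<subseteq> T" and xy: "x \<in> T" "y \<in> T" for T w x y
  proof -
    let ?r = "parcs R \<inter> T \<times> T"
    have sym: "(q, p) \<in> ?r\<^sup>*" if "(p, q) \<in> ?r\<^sup>*" for p q
    proof -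
      have "sym ?r" by (rule symI) (auto intro: arcs_symmetric)
      then show ?thesis using that by (meson sym_rtrancl symD)
    qed
    have seg: "(f i, f j) \<in> ?r\<^sup>*" if "i \<le> j" "j \<le> n" "\<And>k. \<lbrakk>i \<le> k; k \<le> j\<rbrakk> \<Longrightarrow> f k \<in> T" for i j
      using rtrancl_segment[of i j f ?r] step that by simp
    \<comment> \<open>The hub \<open>h\<close> is \<open>a\<close> if the whole path is left. If
      \<open>f j\<close> is missing, it is \<open>v\<close>, reached backwards through
      \<open>a\<close> from before \<open>j\<close> and forwards through \<open>b\<close> from after
      it.\<close>
    have "\<exists>h. \<forall>x\<in>T. (x, h) \<in> ?r\<^sup>*"
    proof (cases "\<forall>k\<le>n. f k \<in> T")
      case True
      have "(x, f 0) \<in> ?r\<^sup>*" if x: "x \<in> T" for x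
      proof (cases "x = v")
        case True
        then show ?thesis using arcs(1) f(1) that \<open>\<forall>k\<le>n. f k \<in> T\<close> by auto
      next
        case False
        then obtain i where "i \<le> n" "x = f i" using T x unfolding S_def by auto
        then show ?thesis using sym[OF seg[of 0 i]] True by auto
      qed
      then show ?thesis by blast
    next
      case False
      then obtain j where j: "j \<le> n" "f j \<notin> T" by blast
      then have TS: "T = S - {f j}" using T unfolding S_def by auto
      then have vT: "v \<in> T" using fV[OF j(1)] unfolding S_def by auto
      have "(x, v) \<in> ?r\<^sup>*" if x: "x \<in> T" for x
      proof (cases "x = v")
        case False
        then obtain i where i: "i \<le> n" "x = f i" using T x unfolding S_def by auto
        then have "i \<noteq> j" using j(2) x by blast
        have inT: "f k \<in> T" if "k \<le> n" "k \<noteq> j" for k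
          using that j(1) inj unfolding TS S_def inj_on_def by blast
        show ?thesis
        proof (cases "i < j")
          case True
          then have "(f i, f 0) \<in> ?r\<^sup>*" using sym[OF seg[of 0 i]] inT i(1) by simp
          moreover have "(f 0, v) \<in> ?r" using arcs_symmetric[OF arcs(1)] f(1) inT[of 0] True vT by simp
          ultimately show ?thesis unfolding i(2) by (rule rtrancl_into_rtrancl)
        next
          case False
          then have "(f i, f n) \<in> ?r\<^sup>*" using seg[of i n] inT i(1) \<open>i \<noteq> j\<close> by simp
          moreover have "(f n, v) \<in> ?r"
            using arcs_symmetric[OF arcs(2)] f(2) inT[of n] False \<open>i \<noteq> j\<close> i(1) vT by simp
          ultimately show ?thesis unfolding i(2) by (rule rtrancl_into_rtrancl)
        qed
      qed simp
      then show ?thesis by blast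
    qed
    then obtain h where "(x, h) \<in> ?r\<^sup>*" "(y, h) \<in> ?r\<^sup>*" using xy by blast
    then show ?thesis using sym[of y h] by (meson rtrancl_trans)
  qed
  have "\<forall>x\<in>S. \<forall>y\<in>S. (x, y) \<in> (parcs R \<inter> S \<times> S)\<^sup>*" using robust[of S v] by blast
  then have "Digraph_Component.connected (with_proj I)"
    unfolding connected_pair_iff[OF I(1)] by (simp add: I_def) (simp add: S_def)
  moreover have "\<not> cut_vertex (with_proj I) w" for w
  proof -
    have "parcs I \<inter> (S - {w}) \<times> (S - {w}) = parcs R \<inter> (S - {w}) \<times> (S - {w})" by (auto simp: I_def)
    then show ?thesis
      unfolding cut_vertex_def reachable_del_vert_iff[OF I.wf_digraph]
      using robust[of "S - {w}" w] by (auto simp: I_def)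
  qed
  ultimately have "two_connected (with_proj I)"
    unfolding two_connected_def using I.pair_graphD_graph by blast
  moreover have "subgraph (with_proj I) (with_proj R)" using I(2) unfolding induced_subgraph_def by blast
  ultimately obtain M where M: "subgraph (with_proj I) M" "block_of (with_proj R) M"
    using max_subgraph_exists[OF fin_digraph, of "with_proj I" two_connected] unfolding block_of_def by metis
  have "a \<in> verts M" "b \<in> verts M"
    using M(1) f unfolding subgraph_def I_def S_def by auto
  moreover have "subgraph M (with_proj R)" using M(2) unfolding block_of_def max_subgraph_def by blast
  then have "arcs_ends M \<subseteq> parcs R" by (auto simp: subgraph_def compatible_def arcs_ends_conv)
  ultimately show ?thesis using complete[OF M(2)] unfolding complete_digraph_def by blast
qed

section \<open>Extended block graphs\<close>

text \<open>A walk avoiding only \<open>v\<close> may still use its twins, so \<open>T\<close> is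
  kept free of them. Contracting the cliques then yields a walk in the block graph that avoids the
  image of \<open>v\<close>, because vertices of one clique are twins.\<close>

lemma extended_block_graph_separated:
  assumes "extended_block_graph B" and arcs: "(v, a) \<in> parcs B" "(v, b) \<in> parcs B"
    and path: "(a, b) \<in> (parcs B \<inter> T \<times> T)\<^sup>*"
    and no_twin: "\<And>w. w \<in> T \<Longrightarrow> insert w {u. (w, u) \<in> parcs B} \<noteq> insert v {u. (v, u) \<in> parcs B}"
  shows "a = b \<or> (a, b) \<in> parcs B"
proof -
  obtain G K where G: "block_graph G" and disj: "disjoint_family_on K (pverts G)"
    and B: "B = clique_substitution G K"
    using assms(1) unfolding extended_block_graph_def by blast
  have "\<forall>x\<in>pverts B. \<exists>u. u \<in> pverts G \<and> x \<in> K u"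
    unfolding B clique_substitution_def by auto
  \<comment> \<open>\<open>\<pi>\<close> contracts each clique to the vertex it replaces.\<close>
  then obtain \<pi> where \<pi>: "\<And>x. x \<in> pverts B \<Longrightarrow> \<pi> x \<in> pverts G \<and> x \<in> K (\<pi> x)" by metis
  have KB: "x \<in> pverts B \<and> \<pi> x = u" if "x \<in> K u" "u \<in> pverts G" for x u
  proof -
    have "x \<in> pverts B" using that unfolding B clique_substitution_def by auto
    then show ?thesis using \<pi>[of x] that disj unfolding disjoint_family_on_def by blast
  qed
  have parcs: "(x, y) \<in> parcs B \<longleftrightarrow> x \<noteq> y \<and> x \<in> pverts B \<and> y \<in> pverts B \<and>
      (\<pi> x = \<pi> y \<or> (\<pi> x, \<pi> y) \<in> parcs G)" (is "?l \<longleftrightarrow> ?r") for x y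
  proof
    assume ?l
    then obtain u w where "x \<noteq> y" "u \<in> pverts G" "w \<in> pverts G" "x \<in> K u" "y \<in> K w" "u = w \<or> (u, w) \<in> parcs G"
      unfolding B clique_substitution_def by auto
    then show ?r using KB by metis
  next
    assume ?r
    then show ?l using \<pi>[of x] \<pi>[of y] by (subst B) (auto simp: clique_substitution_def)
  qed
  have twin: "insert w {u. (w, u) \<in> parcs B} = insert v {u. (v, u) \<in> parcs B}"
    if "w \<in> pverts B" "v \<in> pverts B" "\<pi> w = \<pi> v" for w v
    using that by (auto simp: parcs)
  have vab: "v \<in> pverts B" "a \<in> pverts B" "b \<in> pverts B" "v \<noteq> a" "v \<noteq> b" using arcs parcs by auto
  show ?thesis
  proof (rule ccontr)
    assume n: "\<not> ?thesis"
    have "(\<pi> a, \<pi> b) \<in> (parcs G \<inter> (pverts G - {\<pi> v}) \<times> (pverts G - {\<pi> v}))\<^sup>*"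
      using path
    proof (induction rule: rtrancl_induct)
      case (step s t)
      then have st: "s \<in> pverts B" "t \<in> pverts B" "\<pi> s = \<pi> t \<or> (\<pi> s, \<pi> t) \<in> parcs G" "s \<in> T" "t \<in> T"
        by (auto simp: parcs)
      have "\<pi> s \<noteq> \<pi> v" "\<pi> t \<noteq> \<pi> v" using twin no_twin st vab by blast+
      then have "\<pi> s = \<pi> t \<or> (\<pi> s, \<pi> t) \<in> parcs G \<inter> (pverts G - {\<pi> v}) \<times> (pverts G - {\<pi> v})"
        using st \<pi> by auto
      then show ?case using step.IH by (metis rtrancl.rtrancl_into_rtrancl)
    qed simp
    \<comment> \<open>If \<open>v\<close> shared its clique with \<open>a\<close>, its neighbour
      \<open>b\<close> would be adjacent to \<open>a\<close> too; likewise with \<open>b\<close> for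
      \<open>a\<close>.\<close>
    moreover have "\<pi> v \<noteq> \<pi> a" "\<pi> v \<noteq> \<pi> b"
    proof -
      interpret B: pair_graph B using assms(1) unfolding extended_block_graph_def by blast
      show "\<pi> v \<noteq> \<pi> a" using n vab arcs parcs by auto
      show "\<pi> v \<noteq> \<pi> b" using n vab arcs parcs B.arcs_symmetric by metis
    qed
    then have "(\<pi> v, \<pi> a) \<in> parcs G" "(\<pi> v, \<pi> b) \<in> parcs G" using arcs parcs by auto
    ultimately have "\<pi> a = \<pi> b \<or> (\<pi> a, \<pi> b) \<in> parcs G" using block_graph_separated[OF G] by blast
    then show False using n vab parcs by auto
  qed
qed

lemma block_graph_imp_extended:
  assumes "block_graph B"
  shows "extended_block_graph B"
proof -
  interpret pair_graph B using assms unfolding block_graph_def by blast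
  have "B = clique_substitution B (\<lambda>v. {v})"
    unfolding clique_substitution_def
    by (rule pair_pre_digraph.equality) (auto dest: no_loops' in_arcsD1 in_arcsD2)
  then show ?thesis
    unfolding extended_block_graph_def using assms block_graph_def
    by (intro conjI exI[of _ B] exI[of _ "\<lambda>v. {v}"]) (auto simp: disjoint_family_on_def block_graph_def)
qed

section \<open>The shortest-path metric\<close>

lemma graph_dist_awalk:
  assumes "pair_graph G" "Digraph_Component.connected (with_proj G)" "u \<in> pverts G" "v \<in> pverts G"
  shows "\<exists>p. pre_digraph.awalk (with_proj G) u p v \<and> length p = graph_dist G u v"
proof -
  interpret pair_graph G by fact
  have "strongly_connected (with_proj G)"
    using symmetric_connected_imp_strongly_connected[OF sym_arcs assms(2)] .
  then have "u \<rightarrow>\<^sup>*\<^bsub>with_proj G\<^esub> v" using assms(3,4) unfolding strongly_connected_def by simp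
  then have "\<exists>n p. apath u p v \<and> length p = n" unfolding reachable_apath by blast
  from LeastI_ex[OF this] show ?thesis unfolding graph_dist_def using awalkI_apath by blast
qed

text \<open>\<open>graph_dist\<close> minimises over paths; the detour through \<open>\<mu>\<close>
  extends the bound to all walks, such as concatenations of paths.\<close>

lemma graph_dist_le_awalk:
  assumes "pair_graph G" "pre_digraph.awalk (with_proj G) u p v"
  shows "graph_dist G u v \<le> length p"
proof -
  interpret pair_graph G by fact
  have cost: "awalk_cost (\<lambda>_. 1) p = real (length p)" for p :: "('a \<times> 'a) list"
    by (induct p) auto
  have "u \<rightarrow>\<^sup>*\<^bsub>with_proj G\<^esub> v" using assms(2) unfolding reachable_awalk by blast
  from graph_dist_eq_mu[OF assms(1) this] show ?thesis
    using min_cost_le_walk_cost[OF assms(2), of "\<lambda>_. 1"] by (simp add: cost)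
qed

lemma graph_metric_graph_dist:
  assumes G: "pair_graph G" and con: "Digraph_Component.connected (with_proj G)"
  shows "graph_metric (pverts G) (\<lambda>x y. (x, y) \<in> parcs G) (graph_dist G)"
proof -
  interpret pair_graph G by fact
  note path = graph_dist_awalk[OF G con] and le = graph_dist_le_awalk[OF G]
  have zero: "graph_dist G x y = 0 \<longleftrightarrow> x = y" if "x \<in> pverts G" "y \<in> pverts G" for x y
  proof
    assume "graph_dist G x y = 0"
    then show "x = y" using path[OF that] by (auto simp: awalk_Nil_iff)
  qed (use that le[of x "[]" y] in \<open>simp add: awalk_Nil_iff\<close>)
  have step: "\<exists>z. (x, z) \<in> parcs G \<and> graph_dist G x y = 1 + graph_dist G z y"
    if xy: "x \<in> pverts G" "y \<in> pverts G" "x \<noteq> y" for x y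
  proof -
    obtain p where p: "awalk x p y" "length p = graph_dist G x y"
      using path[OF xy(1,2)] by blast
    then obtain e q where e: "p = e # q" using zero[OF xy(1,2)] xy(3) by (cases p) auto
    then have z: "(x, snd e) \<in> parcs G" "awalk (snd e) q y"
      using p(1) by (auto simp: awalk_Cons_iff)
    then have "snd e \<in> pverts G" using in_arcsD2 by blast
    then obtain r where r: "awalk (snd e) r y" "length r = graph_dist G (snd e) y"
      using path[OF _ xy(2)] by blast
    then have "awalk x ((x, snd e) # r) y" using z(1) by (simp add: awalk_Cons_iff)
    then have "graph_dist G x y \<le> 1 + graph_dist G (snd e) y" using le[of x "(x, snd e) # r" y] r(2) by simp
    moreover have "graph_dist G (snd e) y \<le> length q" using le[OF z(2)] .
    ultimately show ?thesis using z(1) p(2) e by (intro exI[of _ "snd e"]) simp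
  qed
  have one: "graph_dist G x y = 1 \<longleftrightarrow> (x, y) \<in> parcs G" if xy: "x \<in> pverts G" "y \<in> pverts G" for x y
  proof
    assume d: "graph_dist G x y = 1"
    then have "x \<noteq> y" using zero[OF that] by simp
    then obtain z where "(x, z) \<in> parcs G" "graph_dist G z y = 0" using step[of x y] xy d by auto
    then show "(x, y) \<in> parcs G" using zero[of z y] that in_arcsD2 by blast
  next
    assume arc: "(x, y) \<in> parcs G"
    then have "awalk x [(x, y)] y" using that by (simp add: awalk_simps)
    then have "graph_dist G x y \<le> 1" using le[of x "[(x, y)]" y] by simp
    moreover have "graph_dist G x y \<noteq> 0" using zero[OF that] no_loops'[OF arc] by simp
    ultimately show "graph_dist G x y = 1" by simp
  qed
  have rev: "graph_dist G y x \<le> graph_dist G x y" if xy: "x \<in> pverts G" "y \<in> pverts G" for x y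
  proof -
    obtain p where p: "awalk x p y" "length p = graph_dist G x y"
      using path[OF xy] by blast
    have "length (rev_path p) = length p" by (induct p) auto
    then show ?thesis using le[of y "rev_path p" x] p by simp
  qed
  have tri: "graph_dist G x z \<le> graph_dist G x y + graph_dist G y z"
    if xyz: "x \<in> pverts G" "y \<in> pverts G" "z \<in> pverts G" for x y z
  proof -
    obtain p q where "awalk x p y" "length p = graph_dist G x y" "awalk y q z" "length q = graph_dist G y z"
      using path[OF xyz(1,2)] path[OF xyz(2,3)] by blast
    then show ?thesis using le[of x "p @ q" z] by simp
  qed
  show ?thesis
  proof
    show "finite (pverts G)" by (rule pair_finite_verts)
    show "x \<in> pverts G \<and> y \<in> pverts G" if "(x, y) \<in> parcs G" for x y
      using that in_arcsD1 in_arcsD2 by blast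
    show "(y, x) \<in> parcs G" if "(x, y) \<in> parcs G" for x y
      using that by (rule arcs_symmetric)
    show "graph_dist G x y = graph_dist G y x" if "x \<in> pverts G" "y \<in> pverts G" for x y
      using rev[OF that] rev[OF that(2,1)] by simp
  qed (fact zero one tri step)+
qed

section \<open>The two directions for the given graph\<close>

theorem theorem7:
  fixes G :: "'a pair_pre_digraph"
  assumes "pair_graph G" and "Digraph_Component.connected (with_proj G)"
  shows "property_P3 G \<longleftrightarrow> vertebrate_graph G"
proof -
  interpret pair_graph G by fact
  interpret M: graph_metric "pverts G" "\<lambda>x y. (x, y) \<in> parcs G" "graph_dist G"
    using graph_metric_graph_dist[OF assms] .
  have toward: "neighbours_towards G = M.toward"
    unfolding neighbours_towards_def M.toward_def neighbours_def by (intro ext) auto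
  have ball1: "closed_neighbours G = M.ball1"
    unfolding closed_neighbours_def M.ball1_def neighbours_def by (intro ext) auto
  have adj_on: "M.adj_on S = parcs G \<inter> S \<times> S" for S
    unfolding M.adj_on_def by auto
  have P3: "property_P3 G \<longleftrightarrow> (\<exists>R :: 'a pair_pre_digraph. induced_subgraph (with_proj R) (with_proj G) \<and>
      (\<Union>r\<in>pverts R. M.ball1 r) = pverts G \<and>
      (\<forall>c\<in>pverts R. \<forall>x\<in>pverts G. 2 \<le> graph_dist G c x \<longrightarrow>
        (\<exists>c'\<in>M.toward c x \<inter> pverts R. M.splits c x c')))"
    unfolding property_P3_def toward ball1 M.splits_def ..
  show ?thesis
  proof
    assume "property_P3 G"
    then obtain R :: "'a pair_pre_digraph" where R: "induced_subgraph (with_proj R) (with_proj G)"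
        "(\<Union>r\<in>pverts R. M.ball1 r) = pverts G"
      and split: "\<forall>c\<in>pverts R. \<forall>x\<in>pverts G. 2 \<le> graph_dist G c x \<longrightarrow>
        (\<exists>c'\<in>M.toward c x \<inter> pverts R. M.splits c x c')"
      using P3 by metis
    have "pverts G \<noteq> {}" using assms(2) connected_pair_iff[OF assms(1)] by blast
    then have "pverts R \<noteq> {}" using R(2) by blast
    then have gR: "M.gated M.splits (pverts R)"
      unfolding M.gated_def using split induced_subgraph_pairD(1)[OF R(1)] by simp
    \<comment> \<open>The thinned set becomes the backbone; irredundancy is what gives local
      separation.\<close>
    have "\<exists>S\<subseteq>pverts R. M.gated M.splits S \<and> M.irredundant S"
      by (rule M.gated_irredundant_subset[OF _ gR]) (rule M.splits_mono)
    then obtain S where S: "M.gated M.splits S" "M.irredundant S" by blast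
    have gd: "M.gated M.absorbs S" using M.gated_splits_imp_absorbs[OF S(1)] .
    have sep: "M.locally_separated S" using M.gated_splits_locally_separated[OF S] .
    have SV: "S \<subseteq> pverts G" "S \<noteq> {}" using gd unfolding M.gated_def by auto
    define B where "B = \<lparr>pverts = S, parcs = parcs G \<inter> S \<times> S\<rparr>"
    have B: "pair_graph B" "induced_subgraph (with_proj B) (with_proj G)"
      using induced_pair_graph[OF assms(1) SV(1)] unfolding B_def by auto
    have "Digraph_Component.connected (with_proj B)"
      unfolding connected_pair_iff[OF B(1)] using M.gated_connected[OF gd] SV(2)
      by (simp add: B_def adj_on)
    then have "block_graph B"
    proof (rule block_graphI[OF B(1)])
      fix v a b assume va: "(v, a) \<in> parcs B" "(v, b) \<in> parcs B"
        and "(a, b) \<in> (parcs B \<inter> (pverts B - {v}) \<times> (pverts B - {v}))\<^sup>*"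
      moreover have "parcs B \<inter> (pverts B - {v}) \<times> (pverts B - {v}) = M.adj_on (S - {v})"
        unfolding adj_on by (auto simp: B_def)
      ultimately have "b \<in> M.ball1 a" using sep unfolding M.locally_separated_def by (auto simp: B_def)
      then show "a = b \<or> (a, b) \<in> parcs B" using va by (auto simp: B_def M.ball1_def)
    qed
    then have "extended_block_graph B" by (rule block_graph_imp_extended)
    moreover have "\<forall>c\<in>pverts B. \<forall>x\<in>pverts G. 2 \<le> graph_dist G c x \<longrightarrow>
        (\<exists>c'\<in>M.toward c x \<inter> pverts B. \<forall>v\<in>M.toward c x. M.ball1 v \<subseteq> M.ball1 c')"
      using gd unfolding M.gated_def M.absorbs_def by (simp add: B_def)
    ultimately show "vertebrate_graph G"
      unfolding vertebrate_graph_def toward ball1 using assms B(2) by blast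
  next
    assume "vertebrate_graph G"
    then obtain B :: "'a pair_pre_digraph" where B: "induced_subgraph (with_proj B) (with_proj G)"
        "extended_block_graph B"
      and absorb: "\<And>c x. \<lbrakk>c \<in> pverts B; x \<in> pverts G; 2 \<le> graph_dist G c x\<rbrakk> \<Longrightarrow>
        \<exists>c'\<in>M.toward c x \<inter> pverts B. M.absorbs c x c'"
      unfolding vertebrate_graph_def toward ball1 M.absorbs_def by blast
    note BD = induced_subgraph_pairD[OF B(1)]
    have "pair_graph B" "Digraph_Component.connected (with_proj B)"
      using B(2) unfolding extended_block_graph_def by blast+
    then have "pverts B \<noteq> {}" using connected_pair_iff by blast
    then have gB: "M.gated M.absorbs (pverts B)"
      unfolding M.gated_def using absorb BD(1) by blast
    have "\<exists>S\<subseteq>pverts B. M.gated M.absorbs S \<and> M.irredundant S"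
      by (rule M.gated_irredundant_subset[OF _ gB]) (rule M.absorbs_mono)
    then obtain S where S: "S \<subseteq> pverts B" "M.gated M.absorbs S" "M.irredundant S" by blast
    have "M.locally_separated S"
      unfolding M.locally_separated_def
    proof (intro ballI impI, rule ccontr)
      fix v a b assume vab: "v \<in> S" "a \<in> S" "b \<in> S" "(v, a) \<in> parcs G" "(v, b) \<in> parcs G"
        and path: "(a, b) \<in> (M.adj_on (S - {v}))\<^sup>*" and n: "b \<notin> M.ball1 a"
      have arcs: "(v, a) \<in> parcs B" "(v, b) \<in> parcs B" using vab S(1) BD(2) by auto
      have "parcs B \<inter> (S - {v}) \<times> (S - {v}) = M.adj_on (S - {v})"
        unfolding adj_on using S(1) BD(2) by auto
      then have path': "(a, b) \<in> (parcs B \<inter> (S - {v}) \<times> (S - {v}))\<^sup>*" using path by simp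
      have n': "a \<noteq> b" "(a, b) \<notin> parcs G" "(b, a) \<notin> parcs G"
        using n arcs_symmetric[of b a] unfolding M.ball1_def by auto
      \<comment> \<open>A twin \<open>w\<close> of \<open>v\<close> in \<open>S\<close> would be a
        second common neighbour of \<open>a\<close> and \<open>b\<close>, which irredundancy
        forbids.\<close>
      have "insert w {u. (w, u) \<in> parcs B} \<noteq> insert v {u. (v, u) \<in> parcs B}" if w: "w \<in> S - {v}" for w
      proof
        assume "insert w {u. (w, u) \<in> parcs B} = insert v {u. (v, u) \<in> parcs B}"
        then have "a = w \<or> (w, a) \<in> parcs G" "b = w \<or> (w, b) \<in> parcs G" using arcs BD(2) by auto
        then have wab: "(w, a) \<in> parcs G" "(w, b) \<in> parcs G" using n' by auto
        have wS: "w \<in> S" using w by blast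
        note v' = M.common_neighbour_absorbs[OF S(2,3) vab n]
          and w' = M.common_neighbour_absorbs[OF S(2,3) wS vab(2,3) wab n]
        have "w = v" using M.absorbs_unique[OF S(3) w'(1) wS v'(1) vab(1) w'(3) v'(3)] .
        then show False using w by blast
      qed
      from extended_block_graph_separated[OF B(2) arcs path' this] show False using n' BD(2) by auto
    qed
    then have gs: "M.gated M.splits S" using M.separated_gated_splits S by blast
    have SV: "S \<subseteq> pverts G" using gs unfolding M.gated_def by auto
    define R where "R = \<lparr>pverts = S, parcs = parcs G \<inter> S \<times> S\<rparr>"
    have R: "induced_subgraph (with_proj R) (with_proj G)"
      using induced_pair_graph[OF assms(1) SV] unfolding R_def by auto
    have "(\<Union>r\<in>pverts R. M.ball1 r) = pverts G"
    proof
      show "(\<Union>r\<in>pverts R. M.ball1 r) \<subseteq> pverts G"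
        using M.ball1_V SV unfolding R_def pair_pre_digraph.select_convs by blast
      show "pverts G \<subseteq> (\<Union>r\<in>pverts R. M.ball1 r)"
        using M.gated_cover[OF gs] unfolding R_def pair_pre_digraph.select_convs by blast
    qed
    moreover have "\<forall>c\<in>pverts R. \<forall>x\<in>pverts G. 2 \<le> graph_dist G c x \<longrightarrow>
        (\<exists>c'\<in>M.toward c x \<inter> pverts R. M.splits c x c')"
      using gs unfolding M.gated_def by (simp add: R_def)
    ultimately show "property_P3 G"
      unfolding P3 using R by blast
  qed
qed

end
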